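(* Let $d\geq 3$ be an integer and let $\psi(q) = (q\log q)^{-1/d}$. Then for every $x\in\mathbb{R}$, the set $\mathcal{W}_d(\psi)\cap(\{x\}\times\mathbb{R}^{d-1})$ has full $(d-1)$-dimensional Lebesgue measure in $\{x\}\times\mathbb{R}^{d-1}$; that is, for Lebesgue-almost every $(x_2,\dots,x_d)\in\mathbb{R}^{d-1}$ one has $(x,x_2,\dots,x_d)\in\mathcal{W}_d(\psi)$.
   Context: For $\psi:\mathbb{N}\to[0,\infty)$, $\mathcal{W}_d(\psi)$ is the set of $\boldsymbol{x}\in\mathbb{R}^d$ such that $\|q\boldsymbol{x}-\boldsymbol{p}\|_\infty<\psi(q)$ holds for infinitely many $(\boldsymbol{p},q)\in\mathbb{Z}^d\times\mathbb{N}$. The formula for $\psi$ is used for $q\ge 2$; the (finite) value $\psi(1)$ is irrelevant to membership in $\mathcal{W}_d(\psi)$. *)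

theory Defs
  imports "HOL-Analysis.Analysis"
begin

(* Z^d is the set of vectors with integer coordinates in the standard Basis, and infnorm is the
   sup norm of those coordinates. Pairs (p, q), not fractions p / q, are counted, so p and q need
   not be coprime. The side condition 1 <= q excludes the element 0 of the type nat. *)
definition approximable_points :: "(nat \<Rightarrow> real) \<Rightarrow> 'a::euclidean_space set" ("\<W>") where
  "\<W> \<psi> = {v. infinite {(p :: 'a, q :: nat).
      (\<forall>b\<in>Basis. p \<bullet> b \<in> \<int>) \<and> 1 \<le> q \<and> infnorm (real q *\<^sub>R v - p) < \<psi> q}}"

end

theory Submission
  imports Defs "HOL-Real_Asymp.Real_Asymp"
begin

text \<open>Write \<open>\<parallel>\<cdot>\<parallel>\<close> for the distance to the nearest integer and let \<open>Q = {q. \<parallel>q x\<parallel> < \<psi> q}\<close>. The fibre over \<open>x\<close>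
  consists of the \<open>y\<close> that are \<open>\<psi>\<close>-approximable in dimension \<open>d - 1\<close> with infinitely many denominators
  from \<open>Q\<close>. As \<open>d - 1 \<ge> 2\<close>, Gallagher's version of Khintchine's theorem needs no monotonicity, so it
  applies to \<open>\<psi>\<close> cut off outside \<open>Q\<close> and asks only for \<open>\<Sum>q\<in>Q. \<psi> q ^ (d - 1) = \<infinity>\<close>. By the pigeonhole
  principle \<open>Q\<close> has at least about \<open>N \<psi> N\<close> elements up to \<open>N\<close>, for every \<open>x\<close>, and partial summation
  bounds the series below by a multiple of \<open>\<Sum>q. \<psi> q ^ d = \<Sum>q. 1 / (q ln q) = \<infinity>\<close>.

  Gallagher's theorem follows from a second moment bound: the neighbourhoods of the reduced
  fractions with distinct denominators are quasi-independent, and each of them fills its share of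
  any fixed box.\<close>

section \<open>Real numbers with a near-integer multiple\<close>

text \<open>For \<open>m \<ge> 1\<close>, the union of the open intervals of radius
  \<open>\<delta> / m\<close> about all fractions \<open>p / m\<close>, reduced or not.\<close>

definition near_ints :: "nat \<Rightarrow> real \<Rightarrow> real set" where
  "near_ints m \<delta> = {t. \<exists>p::int. \<bar>real m * t - real_of_int p\<bar> < \<delta>}"

lemma near_ints_borel [measurable]: "near_ints m \<delta> \<in> sets borel"
proof -
  have "near_ints m \<delta> = (\<Union>p::int. {t. \<bar>real m * t - real_of_int p\<bar> < \<delta>})"
    by (auto simp: near_ints_def)
  also have "open \<dots>"
    by (intro open_UN ballI open_Collect_less continuous_intros)
  finally show ?thesis by simp
qed

text \<open>A union bound, which reduces upper estimates to counting the numerators whose interval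
  is met.\<close>

lemma measure_cover_intervals_le:
  fixes P :: "int set" and \<delta> :: real
  assumes "finite P" "m \<ge> 1" "\<delta> \<ge> 0" "T \<in> sets borel"
    and sub: "T \<subseteq> (\<Union>p\<in>P. {(p - \<delta>) / real m <..< (p + \<delta>) / real m})"
  shows "measure lborel T \<le> card P * (2 * \<delta> / m)"
proof -
  let ?I = "\<lambda>p::int. {(p - \<delta>) / real m <..< (p + \<delta>) / real m}"
  have "(\<Union>p\<in>P. ?I p) \<in> fmeasurable lborel"
    using assms(1) by (intro fmeasurable.finite_UN) (auto simp: fmeasurable_def emeasure_lborel_box_finite[where 'a = real, simplified])
  then have "measure lborel T \<le> measure lborel (\<Union>p\<in>P. ?I p)"
    using assms(4) sub by (intro measure_mono_fmeasurable) auto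
  also have "\<dots> \<le> (\<Sum>p\<in>P. measure lborel (?I p))"
    using assms(1) by (intro measure_UNION_le) auto
  also have "\<dots> = (\<Sum>p\<in>P. 2 * \<delta> / m)"
    using assms by (intro sum.cong refl) (auto simp: measure_def field_simps)
  finally show ?thesis by simp
qed

text \<open>At most \<open>m * (u - l) + 2\<close> numerators matter, because
  \<open>2 * \<delta> \<le> 1\<close>; the summand 2 becomes the boundary term
  \<open>4 * \<delta> / m\<close>.\<close>

lemma measure_near_ints_le:
  fixes \<delta> l u :: real
  assumes "m \<ge> 1" "0 \<le> \<delta>" "\<delta> \<le> 1/2" "l \<le> u"
  shows "measure lborel (near_ints m \<delta> \<inter> {l..u}) \<le> 2 * \<delta> * (u - l) + 4 * \<delta> / m"
proof -
  define P where "P = {\<lceil>m * l - \<delta>\<rceil> .. \<lfloor>m * u + \<delta>\<rfloor>}"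
  have sub: "near_ints m \<delta> \<inter> {l..u} \<subseteq> (\<Union>p\<in>P. {(p - \<delta>) / m <..< (p + \<delta>) / m})"
  proof
    fix t assume t: "t \<in> near_ints m \<delta> \<inter> {l..u}"
    then obtain p :: int where p: "\<bar>m * t - p\<bar> < \<delta>" by (auto simp: near_ints_def)
    have "m * l \<le> m * t" "m * t \<le> m * u" using t by (auto intro!: mult_left_mono)
    with p have "m * l - \<delta> \<le> p" "p \<le> m * u + \<delta>" by linarith+
    then have "p \<in> P" unfolding P_def by (simp add: ceiling_le_iff le_floor_iff)
    moreover have "t \<in> {(p - \<delta>) / m <..< (p + \<delta>) / m}"
      using p assms(1) by (auto simp: field_simps abs_less_iff)
    ultimately show "t \<in> (\<Union>p\<in>P. {(p - \<delta>) / m <..< (p + \<delta>) / m})" by blast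
  qed
  have "m * l \<le> m * u" using assms by (intro mult_left_mono) auto
  then have "real (card P) \<le> (m * u + \<delta>) - (m * l - \<delta>) + 1"
    using assms(2) unfolding P_def card_atLeastAtMost_int by linarith
  also have "\<dots> \<le> m * (u - l) + 2" using assms(3) by (simp add: algebra_simps)
  finally have "real (card P) \<le> m * (u - l) + 2" .
  from mult_right_mono[OF this, of "2 * \<delta> / m"]
  have "card P * (2 * \<delta> / m) \<le> (m * (u - l) + 2) * (2 * \<delta> / m)"
    using assms by simp
  also have "\<dots> = 2 * \<delta> * (u - l) + 4 * \<delta> / m"
    using assms(1) by (simp add: field_simps)
  finally show ?thesis
    using measure_cover_intervals_le[OF _ assms(1,2) _ sub] by (auto simp: P_def)
qed

text \<open>Only intervals inside \<open>{l..u}\<close> are counted. They are pairwise disjoint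
  because \<open>\<delta> \<le> 1/2\<close>, and there are at least \<open>m * (u - l) - 2\<close>
  of them.\<close>

lemma measure_near_ints_ge:
  fixes \<delta> l u :: real
  assumes "m \<ge> 1" "0 \<le> \<delta>" "\<delta> \<le> 1/2"
  shows "measure lborel (near_ints m \<delta> \<inter> {l..u}) \<ge> 2 * \<delta> * (u - l) - 4 * \<delta> / m"
proof -
  let ?I = "\<lambda>p::int. {(p - \<delta>) / real m <..< (p + \<delta>) / real m}"
  define P where "P = {\<lceil>m * l + \<delta>\<rceil> .. \<lfloor>m * u - \<delta>\<rfloor>}"
  have I: "t \<in> ?I p \<longleftrightarrow> \<bar>m * t - p\<bar> < \<delta>" for t :: real and p
    using assms(1) by (auto simp: field_simps abs_less_iff)
  have disj: "disjoint_family_on ?I P"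
    unfolding disjoint_family_on_def
  proof (intro ballI impI equals0I)
    fix p p' t assume "p \<noteq> p'" "t \<in> ?I p \<inter> ?I p'"
    then have "\<bar>m * t - p\<bar> < \<delta>" "\<bar>m * t - p'\<bar> < \<delta>" using I by blast+
    with \<open>p \<noteq> p'\<close> assms(3) show False by linarith
  qed
  have sub: "(\<Union>p\<in>P. ?I p) \<subseteq> near_ints m \<delta> \<inter> {l..u}"
  proof
    fix t assume "t \<in> (\<Union>p\<in>P. ?I p)"
    then obtain p where p: "p \<in> P" "\<bar>m * t - p\<bar> < \<delta>" using I by blast
    then have "m * l + \<delta> \<le> p" "p \<le> m * u - \<delta>"
      unfolding P_def by (simp_all add: ceiling_le_iff le_floor_iff)
    with p have "m * l \<le> m * t" "m * t \<le> m * u" by linarith+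
    with assms(1) p show "t \<in> near_ints m \<delta> \<inter> {l..u}" by (auto simp: near_ints_def)
  qed
  have "real (card P) \<ge> m * (u - l) - 2"
    using assms unfolding P_def by (simp add: algebra_simps) linarith
  then have "card P * (2 * \<delta> / m) \<ge> (m * (u - l) - 2) * (2 * \<delta> / m)"
    using assms by (intro mult_right_mono) auto
  moreover have "(m * (u - l) - 2) * (2 * \<delta> / m) = 2 * \<delta> * (u - l) - 4 * \<delta> / m"
    using assms(1) by (simp add: field_simps)
  moreover have "card P * (2 * \<delta> / m) = (\<Sum>p\<in>P. measure lborel (?I p))"
    using assms by (simp add: measure_def field_simps)
  moreover have "(\<Sum>p\<in>P. measure lborel (?I p)) = measure lborel (\<Union>p\<in>P. ?I p)"
    using disj by (intro measure_finite_Union[symmetric])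
      (auto simp: P_def simp: order.strict_implies_not_eq[OF emeasure_lborel_box_finite[where 'a = real, simplified]])
  moreover have "measure lborel (\<Union>p\<in>P. ?I p) \<le> measure lborel (near_ints m \<delta> \<inter> {l..u})"
    using sub by (intro measure_mono_fmeasurable) (auto intro!: fmeasurableI emeasure_bounded_finite)
  ultimately show ?thesis by linarith
qed

text \<open>With \<open>g = gcd q r\<close>, the map sending a centre \<open>p / q\<close> to the pair of
  \<open>r' p - q' p'\<close> and \<open>p div q'\<close> is injective, which bounds the number of centres involved.\<close>

lemma measure_near_ints_pair_le_aux:
  fixes q r :: nat and a b :: real
  assumes "q \<ge> 1" "r \<ge> 1" "0 \<le> a" "a \<le> 1/2" "0 \<le> b"
    and le: "a * (r div gcd q r) \<le> b * (q div gcd q r)"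
    and ge: "a * (r div gcd q r) + b * (q div gcd q r) \<ge> 1"
  shows "measure lborel (near_ints q a \<inter> near_ints r b \<inter> {0..1}) \<le> 24 * a * b"
proof -
  define g where "g = gcd q r"
  define q' r' where "q' = q div g" and "r' = r div g"
  have g: "g \<ge> 1" "q = g * q'" "r = g * r'"
    using assms(1) by (auto simp: g_def q'_def r'_def Suc_le_eq)
  then have q'r': "q' \<ge> 1" "r' \<ge> 1" using assms(1,2) by (cases q'; cases r'; simp)+
  have cop: "coprime q' r'"
    using assms(1) unfolding q'_def r'_def g_def by (intro div_gcd_coprime) auto
  \<comment> \<open>By \<open>le\<close> the summand \<open>b * q'\<close> is the larger one, so its
    double bounds the sum. Multiplying by the number of periods, about \<open>g\<close>, gives a
    count of order \<open>b * q\<close>.\<close>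
  define L where "L = 2 * b * q'"
  have L: "a * r' + b * q' \<le> L" "L \<ge> 1"
    using le ge unfolding L_def q'_def r'_def g_def by auto
  define P :: "int set" where "P = {p \<in> {0..int q}. \<exists>p'::int. \<bar>r' * p - q' * p'\<bar> < L}"
  have sub: "near_ints q a \<inter> near_ints r b \<inter> {0..1} \<subseteq> (\<Union>p\<in>P. {(p - a) / q <..< (p + a) / q})"
  proof
    fix t assume t: "t \<in> near_ints q a \<inter> near_ints r b \<inter> {0..1}"
    then obtain p p' :: int where p: "\<bar>q * t - p\<bar> < a" "\<bar>r * t - p'\<bar> < b"
      by (auto simp: near_ints_def)
    have "0 \<le> q * t" "q * t \<le> q * 1" using t mult_left_mono[of t 1 "real q"] by auto
    with p(1) assms(4) have 1: "p \<in> {0..int q}" by (auto; linarith)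
    \<comment> \<open>The terms with \<open>t\<close> cancel because
      \<open>r' * q = q' * r\<close>.\<close>
    have "r' * p - q' * p' = r' * (p - q * t) + q' * (r * t - p')"
      by (simp add: g algebra_simps)
    also have "\<bar>\<dots>\<bar> \<le> r' * \<bar>q * t - p\<bar> + q' * \<bar>r * t - p'\<bar>"
      by (intro abs_triangle_ineq[THEN order_trans]) (simp add: abs_mult abs_minus_commute)
    also have "\<dots> < r' * a + q' * b"
      using p q'r' by (intro add_strict_mono mult_strict_left_mono) auto
    also have "\<dots> \<le> L" using L by (simp add: mult.commute)
    finally have "p \<in> P" using 1 unfolding P_def by (auto intro!: exI[of _ p'])
    moreover have "t \<in> {(p - a) / q <..< (p + a) / q}"
      using p assms(1) by (auto simp: field_simps abs_less_iff)
    ultimately show "t \<in> (\<Union>p\<in>P. {(p - a) / q <..< (p + a) / q})" by blast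
  qed
  define c :: "int \<Rightarrow> int" where "c = (\<lambda>p :: int. SOME p' :: int. \<bar>r' * p - q' * p'\<bar> < L)"
  have c: "\<bar>r' * p - q' * c p\<bar> < L" if "p \<in> P" for p :: int
    using that unfolding P_def c_def by (auto intro: someI_ex)
  define f where "f = (\<lambda>p :: int. (r' * p - q' * c p, p div q'))"
  \<comment> \<open>The first component fixes \<open>r' * p\<close> modulo \<open>q'\<close>, hence
    \<open>p\<close> modulo \<open>q'\<close> by coprimality; the second fixes the quotient.\<close>
  have "inj_on f P"
  proof (rule inj_onI)
    fix p1 p2 assume "f p1 = f p2"
    then have 1: "r' * p1 - q' * c p1 = r' * p2 - q' * c p2" and 2: "p1 div q' = p2 div q'"
      by (auto simp: f_def)
    have "int r' * (p1 - p2) = q' * (c p1 - c p2)" using 1 by (simp add: algebra_simps)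
    then have "int q' dvd int r' * (p1 - p2)" by simp
    with cop have "int q' dvd p1 - p2" by (simp add: coprime_dvd_mult_right_iff)
    then have "p1 mod q' = p2 mod q'" by (simp add: mod_eq_dvd_iff)
    with 2 show "p1 = p2" by (metis div_mult_mod_eq)
  qed
  moreover have "f ` P \<subseteq> {\<lceil>-L\<rceil>..\<lfloor>L\<rfloor>} \<times> {0..int g}"
  proof
    fix z assume "z \<in> f ` P"
    then obtain p where p: "p \<in> P" "z = f p" by auto
    have "real_of_int (r' * p - q' * c p) = r' * p - q' * c p" by simp
    then have "-L \<le> real_of_int (r' * p - q' * c p)" "real_of_int (r' * p - q' * c p) \<le> L"
      using c[OF p(1)] by linarith+
    then have "r' * p - q' * c p \<in> {\<lceil>-L\<rceil>..\<lfloor>L\<rfloor>}" by (auto simp only: atLeastAtMost_iff ceiling_le_iff le_floor_iff)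
    moreover have "p div q' \<le> int q div int q'" "0 \<le> p div q'"
      using p(1) q'r' by (auto simp: P_def intro!: zdiv_mono1 pos_imp_zdiv_nonneg_iff[THEN iffD2])
    moreover have "int q div int q' = int g" using g q'r' by simp
    ultimately show "z \<in> {\<lceil>-L\<rceil>..\<lfloor>L\<rfloor>} \<times> {0..int g}" using p(2) by (auto simp: f_def)
  qed
  ultimately have "card P \<le> card ({\<lceil>-L\<rceil>..\<lfloor>L\<rfloor>} \<times> {0..int g})"
    by (intro card_inj_on_le) auto
  also have "\<dots> = card {\<lceil>-L\<rceil>..\<lfloor>L\<rfloor>} * (g + 1)" by (simp add: card_cartesian_product nat_add_distrib)
  finally have "real (card P) \<le> card {\<lceil>-L\<rceil>..\<lfloor>L\<rfloor>} * (real g + 1)"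
    by (metis of_nat_1 of_nat_add of_nat_le_iff of_nat_mult)
  \<comment> \<open>As \<open>L \<ge> 1\<close>, the symmetric range holds at most
    \<open>2 * L + 1 \<le> 3 * L\<close> integers; also \<open>g + 1 \<le> 2 * g\<close>.\<close>
  also have "\<dots> \<le> (3 * L) * (2 * g)"
    using L g by (intro mult_mono) (auto, linarith)
  also have "\<dots> = 12 * b * q" by (simp add: L_def g)
  finally have "card P * (2 * a / q) \<le> 12 * b * q * (2 * a / q)"
    using assms by (intro mult_right_mono) auto
  moreover have "measure lborel (near_ints q a \<inter> near_ints r b \<inter> {0..1}) \<le> card P * (2 * a / q)"
    using assms by (intro measure_cover_intervals_le sub finite_subset[of P "{0..int q}"]) (auto simp: P_def)
  moreover have "12 * b * q * (2 * a / q) = 24 * a * b" using assms(1) by simp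
  ultimately show ?thesis by linarith
qed

text \<open>The two cases exchange the roles of \<open>(q, a)\<close> and \<open>(r, b)\<close>. The
  last hypothesis is the exact complement of the disjointness condition in
  \<open>near_reduced_disjoint\<close>.\<close>

lemma measure_near_ints_pair_le:
  fixes q r :: nat and a b :: real
  assumes "q \<ge> 1" "r \<ge> 1" "0 \<le> a" "a \<le> 1/2" "0 \<le> b" "b \<le> 1/2"
    and "a * (r div gcd q r) + b * (q div gcd q r) \<ge> 1"
  shows "measure lborel (near_ints q a \<inter> near_ints r b \<inter> {0..1}) \<le> 24 * a * b"
proof (cases "a * (r div gcd q r) \<le> b * (q div gcd q r)")
  case True
  then show ?thesis using measure_near_ints_pair_le_aux[of q r a b] assms by simp
next
  case False
  then show ?thesis
    using measure_near_ints_pair_le_aux[of r q b a] assms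
    by (simp add: gcd.commute Int_commute add.commute mult_ac)
qed

section \<open>From single coordinates to vectors\<close>

lemma borel_vec_box:
  fixes T :: "'n::finite \<Rightarrow> real set"
  assumes T: "\<And>i. T i \<in> sets borel"
  shows "{y :: real^'n. \<forall>i. y $ i \<in> T i} \<in> sets borel"
proof -
  have "{y :: real^'n. \<forall>i. y $ i \<in> T i} = (\<Inter>i. (\<lambda>y. y $ i) -` T i \<inter> space borel)" by auto
  also have "\<dots> \<in> sets borel"
    by (intro sets.finite_INT measurable_sets[OF _ T] borel_measurable_continuous_onI continuous_intros) auto
  finally show ?thesis .
qed

text \<open>Lebesgue measure is a product over \<open>Basis\<close>, whose elements are the vectors
  \<open>axis i 1\<close>; reindexing yields the product over coordinates.\<close>

lemma measure_lborel_vec_box: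
  fixes T :: "'n::finite \<Rightarrow> real set"
  assumes T [measurable]: "\<And>i. T i \<in> sets borel"
  shows "measure lborel {y :: real^'n. \<forall>i. y $ i \<in> T i} = (\<Prod>i\<in>UNIV. measure lborel (T i))"
proof -
  have Basis: "(Basis :: (real^'n) set) = (\<lambda>i. axis i 1) ` UNIV"
    by (auto simp: Basis_vec_def)
  have inj: "inj (\<lambda>i. axis i 1 :: real^'n)" by (auto simp: inj_on_def axis_eq_axis)
  define j where "j = inv (\<lambda>i. axis i 1 :: real^'n)"
  have j: "j (axis i 1) = i" for i unfolding j_def using inj by (rule inv_f_f)
  have "emeasure lborel {y :: real^'n. \<forall>i. y $ i \<in> T i} =
    nn_integral lborel (\<lambda>y :: real^'n. indicator {y. \<forall>i. y $ i \<in> T i} y)"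
    using borel_vec_box[of T] by simp
  also have "\<dots> = nn_integral lborel (\<lambda>y :: real^'n. \<Prod>b\<in>Basis. indicator (T (j b)) (y \<bullet> b))"
    unfolding Basis using inj
    by (intro nn_integral_cong, subst prod.reindex)
       (auto simp: j inner_axis indicator_def prod_zero_iff)
  also have "\<dots> = (\<Prod>b\<in>(Basis :: (real^'n) set). emeasure lborel (T (j b)))"
    by (subst nn_integral_lborel_prod) (auto simp: nn_integral_indicator)
  also have "\<dots> = (\<Prod>i\<in>UNIV. emeasure lborel (T i))"
    unfolding Basis using inj by (subst prod.reindex) (auto simp: j)
  finally have "measure lborel {y :: real^'n. \<forall>i. y $ i \<in> T i} =
    enn2real (\<Prod>i\<in>UNIV. emeasure lborel (T i))" by (simp add: measure_def)
  also have "enn2real (\<Prod>i\<in>I. emeasure lborel (T i)) = (\<Prod>i\<in>I. measure lborel (T i))" for I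
    by (induction I rule: infinite_finite_induct) (auto simp: enn2real_mult measure_def)
  finally show ?thesis .
qed

section \<open>Neighbourhoods of reduced fractions\<close>

text \<open>Only those \<open>p\<close> count whose entries have no common factor with \<open>q\<close>. Then \<open>p / q \<noteq> p' / r\<close> for
  \<open>q \<noteq> r\<close>, so two of these sets are disjoint unless their radii are so large that the trivial
  overlap \<open>p / q = p' / r\<close> of single coordinates is harmless.\<close>

definition near_reduced :: "nat \<Rightarrow> real \<Rightarrow> (real^'n) set" where
  "near_reduced q \<delta> = {y. \<exists>p :: 'n \<Rightarrow> int.
      (\<forall>e. e dvd q \<longrightarrow> (\<forall>i. int e dvd p i) \<longrightarrow> e = 1) \<and> (\<forall>i. \<bar>real q * y $ i - p i\<bar> < \<delta>)}"

lemma open_near_reduced: "open (near_reduced q \<delta> :: (real^'n) set)"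
proof -
  let ?R = "{p :: 'n \<Rightarrow> int. \<forall>e. e dvd q \<longrightarrow> (\<forall>i. int e dvd p i) \<longrightarrow> e = 1}"
  have "near_reduced q \<delta> = (\<Union>p\<in>?R. \<Inter>i. {y :: real^'n. \<bar>real q * y $ i - p i\<bar> < \<delta>})"
    by (auto simp: near_reduced_def)
  also have "open \<dots>"
    by (intro open_UN open_INT finite ballI open_Collect_less continuous_intros)
  finally show ?thesis .
qed

lemma near_reduced_subset: "near_reduced q \<delta> \<subseteq> {y. \<forall>i. y $ i \<in> near_ints q \<delta>}"
  by (auto simp: near_reduced_def near_ints_def)

text \<open>At a common point the integers \<open>r' * p i - q' * p' i\<close> have absolute value
  below 1, so they vanish. By coprimality \<open>q'\<close> divides every \<open>p i\<close> and
  \<open>r'\<close> every \<open>p' i\<close>; reducedness forces \<open>q' = r' = 1\<close>, hence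
  \<open>q = r\<close>.\<close>

lemma near_reduced_disjoint:
  fixes q r :: nat and a b :: real
  assumes "q \<ge> 1" "r \<ge> 1" "q \<noteq> r"
    and lt: "a * (r div gcd q r) + b * (q div gcd q r) < 1"
  shows "near_reduced q a \<inter> (near_reduced r b :: (real^'n) set) = {}"
proof (rule equals0I)
  fix y :: "real^'n" assume y: "y \<in> near_reduced q a \<inter> near_reduced r b"
  obtain p where p: "\<And>e. e dvd q \<Longrightarrow> (\<forall>i. int e dvd p i) \<Longrightarrow> e = 1" "\<And>i. \<bar>real q * y $ i - p i\<bar> < a"
    using y unfolding near_reduced_def by blast
  obtain p' where p': "\<And>e. e dvd r \<Longrightarrow> (\<forall>i. int e dvd p' i) \<Longrightarrow> e = 1" "\<And>i. \<bar>real r * y $ i - p' i\<bar> < b"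
    using y unfolding near_reduced_def by blast
  define g where "g = gcd q r"
  define q' r' where "q' = q div g" and "r' = r div g"
  have g: "q = g * q'" "r = g * r'"
    by (auto simp: g_def q'_def r'_def)
  then have q'r': "q' \<ge> 1" "r' \<ge> 1" using assms(1,2) by (cases q'; cases r'; simp)+
  have cop: "coprime q' r'"
    using assms(1) unfolding q'_def r'_def g_def by (intro div_gcd_coprime) auto
  have eq: "int r' * p i = q' * p' i" for i
  proof -
    have "real_of_int (r' * p i - q' * p' i) = r' * (p i - q * y $ i) + q' * (r * y $ i - p' i)"
      by (simp add: g algebra_simps)
    also have "\<bar>\<dots>\<bar> \<le> r' * \<bar>q * y $ i - p i\<bar> + q' * \<bar>r * y $ i - p' i\<bar>"
      by (intro abs_triangle_ineq[THEN order_trans]) (simp add: abs_mult abs_minus_commute)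
    also have "\<dots> < r' * a + q' * b"
      using p(2)[of i] p'(2)[of i] q'r' by (intro add_strict_mono mult_strict_left_mono) auto
    also have "\<dots> < 1" using lt by (simp add: q'_def r'_def g_def mult.commute)
    finally show ?thesis by linarith
  qed
  have "int q' dvd p i" for i
  proof -
    have "int q' dvd int r' * p i" by (simp add: eq)
    with cop show ?thesis by (simp add: coprime_dvd_mult_right_iff)
  qed
  then have "q' = 1" using p(1)[of q'] g by simp
  have "int r' dvd p' i" for i
  proof -
    have "int r' dvd int q' * p' i" by (simp flip: eq)
    with cop show ?thesis by (simp add: coprime_dvd_mult_right_iff coprime_commute)
  qed
  then have "r' = 1" using p'(1)[of r'] g by simp
  with \<open>q' = 1\<close> g assms(3) show False by simp
qed

lemma near_reduced_borel [measurable]: "near_reduced q \<delta> \<in> sets borel"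
  using open_near_reduced by (rule borel_open)

section \<open>Measure estimates for the reduced neighbourhoods\<close>

lemma measure_vec_le_power:
  fixes S :: "(real^'n) set"
  assumes "S \<in> sets borel" "S \<subseteq> {y. \<forall>i. y $ i \<in> T}" "T \<in> sets borel" "bounded T"
    "measure lborel T \<le> c"
  shows "measure lborel S \<le> c ^ CARD('n)"
proof -
  have "bounded {y :: real^'n. \<forall>i. y $ i \<in> T}"
  proof -
    obtain B where B: "\<And>t. t \<in> T \<Longrightarrow> \<bar>t\<bar> \<le> B" using assms(4) by (auto simp: bounded_real)
    have "norm y \<le> (\<Sum>i\<in>(UNIV :: 'n set). B)" if "\<forall>i. y $ i \<in> T" for y :: "real^'n"
      by (rule order_trans[OF norm_le_l1_cart], rule sum_mono) (use that B in auto)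
    then show ?thesis by (intro boundedI) blast
  qed
  moreover have "{y :: real^'n. \<forall>i. y $ i \<in> T} \<in> sets borel"
    using assms(3) by (rule borel_vec_box)
  ultimately have "{y :: real^'n. \<forall>i. y $ i \<in> T} \<in> fmeasurable lborel"
    by (intro fmeasurableI emeasure_bounded_finite) auto
  then have "measure lborel S \<le> measure lborel {y :: real^'n. \<forall>i. y $ i \<in> T}"
    using assms by (intro measure_mono_fmeasurable) auto
  also have "\<dots> = measure lborel T ^ CARD('n)"
    using measure_lborel_vec_box[of "\<lambda>_. T"] assms(3) by simp
  also have "\<dots> \<le> c ^ CARD('n)" using assms(5) by (intro power_mono) auto
  finally show ?thesis .
qed

lemma measure_near_reduced_le:
  assumes "q \<ge> 1" "0 \<le> a" "a \<le> 1/2"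
  shows "measure lborel (near_reduced q a \<inter> (cbox 0 1 :: (real^'n) set)) \<le> 24 ^ CARD('n) * a ^ CARD('n)"
  unfolding power_mult_distrib[symmetric]
proof (rule measure_vec_le_power)
  show "near_reduced q a \<inter> (cbox 0 1 :: (real^'n) set) \<subseteq> {y. \<forall>i. y $ i \<in> near_ints q a \<inter> {0..1}}"
    using near_reduced_subset[of q a] by (auto simp: mem_box_cart)
  \<comment> \<open>The sum is at most \<open>6 * a\<close>. The weaker 24 is the constant of the
    pair estimate, so that one \<open>C\<close> can serve for both later.\<close>
  have "2 * a * (1 - 0) + 4 * a / q \<le> 2 * a + 4 * a"
    using assms mult_left_mono[of 1 "real q" a] by (auto simp: field_simps)
  then show "measure lborel (near_ints q a \<inter> {0..1}) \<le> 24 * a"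
    using measure_near_ints_le[of q a 0 1] assms by linarith
qed auto

text \<open>A dichotomy: either the two sets are disjoint, or the one-dimensional overlap bound
  applies in every coordinate.\<close>

lemma measure_near_reduced_pair_le:
  assumes "q \<ge> 1" "r \<ge> 1" "q \<noteq> r" "0 \<le> a" "a \<le> 1/2" "0 \<le> b" "b \<le> 1/2"
  shows "measure lborel (near_reduced q a \<inter> near_reduced r b \<inter> (cbox 0 1 :: (real^'n) set))
    \<le> 24 ^ CARD('n) * a ^ CARD('n) * b ^ CARD('n)"
proof (cases "a * (r div gcd q r) + b * (q div gcd q r) < 1")
  case True
  then have "near_reduced q a \<inter> (near_reduced r b :: (real^'n) set) = {}"
    using assms by (intro near_reduced_disjoint) auto
  with assms show ?thesis by simp
next
  case False
  then have *: "measure lborel (near_ints q a \<inter> near_ints r b \<inter> {0..1}) \<le> 24 * a * b"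
    using assms by (intro measure_near_ints_pair_le) auto
  have sub: "near_reduced q a \<inter> near_reduced r b \<inter> (cbox 0 1 :: (real^'n) set)
      \<subseteq> {y. \<forall>i. y $ i \<in> near_ints q a \<inter> near_ints r b \<inter> {0..1}}"
    using near_reduced_subset[of q a] near_reduced_subset[of r b] by (auto simp: mem_box_cart)
  show ?thesis
    unfolding power_mult_distrib[symmetric]
    by (rule measure_vec_le_power[OF _ sub _ _ *]) auto
qed

text \<open>Telescoping, started from the exact value 1/4 at \<open>n = 2\<close>. The bound has to
  stay clearly below 1 for a positive proportion to survive the sieve that follows.\<close>

lemma sum_inverse_squares_le:
  assumes "n \<ge> 2"
  shows "(\<Sum>e=2..n. 1 / (real e)\<^sup>2) \<le> 3/4 - 1 / n"
  using assms
proof (induction n rule: dec_induct)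
  case (step m)
  have "1 / (real (Suc m))\<^sup>2 \<le> 1 / (real m * real (Suc m))"
    using step.hyps unfolding power2_eq_square by (intro divide_left_mono mult_right_mono) auto
  also have "\<dots> = 1 / m - 1 / Suc m"
    using step.hyps by (simp add: field_simps)
  finally have "1 / (real (Suc m))\<^sup>2 \<le> 1 / m - 1 / Suc m" .
  with step show ?case by simp
qed simp

text \<open>Removing, for every divisor \<open>e \<ge> 2\<close> of \<open>q\<close>, the points near those \<open>p\<close> that \<open>e\<close> divides
  leaves \<open>near_reduced\<close>; as \<open>CARD('n) \<ge> 2\<close> this costs at most the proportion
  \<open>\<Sum>\<^sub>e e\<^sup>-\<^sup>2 \<le> 3/4\<close>, up to a boundary term. The estimate \<open>(1/e + \<kappa>)\<^sup>2 \<le> 11/10 e\<^sup>-\<^sup>2 + 11 \<kappa>\<^sup>2\<close> keeps the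
  boundary terms summable.\<close>

lemma measure_near_reduced_ge:
  fixes l u :: "real^'n"
  assumes card: "CARD('n) \<ge> 2" and lu: "\<And>i. l $ i < u $ i"
  shows "\<forall>\<^sub>F q in sequentially. \<forall>\<delta>. 0 \<le> \<delta> \<longrightarrow> \<delta> \<le> 1/2 \<longrightarrow>
    measure lborel (near_reduced q \<delta> \<inter> cbox l u) \<ge> 1/10 * \<delta> ^ CARD('n) * measure lborel (cbox l u)"
proof -
  define s where "s = Min (range (\<lambda>i. u $ i - l $ i))"
  have s: "s \<le> u $ i - l $ i" for i by (simp add: s_def)
  have "s > 0" unfolding s_def using lu by (subst Min_gr_iff) auto
  \<comment> \<open>The boundary error relative to the shortest side \<open>s\<close>:
    \<open>4 * \<delta> / q = 2 * \<delta> * s * k q\<close>.\<close>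
  define k where "k q = 2 / (real q * s)" for q
  have k0: "k \<longlonglongrightarrow> 0" unfolding k_def using \<open>s > 0\<close> by real_asymp
  have "(\<lambda>q. (1 - k q) ^ CARD('n) - 44 / s\<^sup>2 / q) \<longlonglongrightarrow> (1 - 0) ^ CARD('n) - 0"
    by (intro tendsto_intros k0)
  \<comment> \<open>37/40 exceeds the sieve loss 11/10 * 3/4 = 33/40 by exactly the final constant
    1/10.\<close>
  then have "\<forall>\<^sub>F q in sequentially. (1 - k q) ^ CARD('n) - 44 / s\<^sup>2 / q > 37/40"
    by (rule order_tendstoD) auto
  moreover have "\<forall>\<^sub>F q in sequentially. k q < 1/2"
    by (rule order_tendstoD[OF k0]) auto
  moreover have "\<forall>\<^sub>F q in sequentially. q \<ge> (2::nat)" by (rule eventually_ge_at_top)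
  ultimately show ?thesis
  proof eventually_elim
    case (elim q)
    show ?case
    proof (intro allI impI)
      fix \<delta> :: real assume \<delta>: "0 \<le> \<delta>" "\<delta> \<le> 1/2"
      define V where "V = (\<Prod>i\<in>UNIV. u $ i - l $ i)"
      have V: "V > 0" unfolding V_def using lu by (intro prod_pos) auto
      have Veq: "measure lborel (cbox l u) = V"
        unfolding V_def using lu by (subst content_cbox_cart) (auto simp: interval_ne_empty_cart less_imp_le)
      define E where "E = {e\<in>{2..q}. e dvd q}"
      define B :: "nat \<Rightarrow> real \<Rightarrow> (real^'n) set"
        where "B m \<eta> = {y. \<forall>i. y $ i \<in> near_ints m \<eta> \<inter> {l $ i..u $ i}}" for m \<eta>
      have B: "measure lborel (B m \<eta>) = (\<Prod>i\<in>UNIV. measure lborel (near_ints m \<eta> \<inter> {l $ i..u $ i}))" for m \<eta>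
        unfolding B_def by (rule measure_lborel_vec_box) auto
      have Bborel: "B m \<eta> \<in> sets borel" for m \<eta>
        unfolding B_def by (rule borel_vec_box) auto
      have Bfin: "B m \<eta> \<in> fmeasurable lborel" for m \<eta>
      proof (rule fmeasurableI2[OF fmeasurable_cbox])
        show "B m \<eta> \<subseteq> cbox l u" by (auto simp: B_def mem_box_cart)
      qed (simp add: Bborel)
      have Afin: "near_reduced q \<delta> \<inter> cbox l u \<in> fmeasurable lborel"
        by (rule fmeasurableI2[OF fmeasurable_cbox]) auto
      \<comment> \<open>If \<open>e\<close> divides \<open>q\<close> and all \<open>p i\<close>,
        cancelling it gives denominator \<open>q div e\<close> and tolerance
        \<open>\<delta> / e\<close>.\<close>
      have sub: "B q \<delta> \<subseteq> (near_reduced q \<delta> \<inter> cbox l u) \<union> (\<Union>e\<in>E. B (q div e) (\<delta> / e))"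
      proof
        fix y assume y: "y \<in> B q \<delta>"
        then have "\<forall>i. \<exists>p::int. \<bar>real q * y $ i - p\<bar> < \<delta>" by (auto simp: B_def near_ints_def)
        then obtain p :: "'n \<Rightarrow> int" where p: "\<And>i. \<bar>real q * y $ i - p i\<bar> < \<delta>" by metis
        show "y \<in> (near_reduced q \<delta> \<inter> cbox l u) \<union> (\<Union>e\<in>E. B (q div e) (\<delta> / e))"
        proof (cases "\<forall>e. e dvd q \<longrightarrow> (\<forall>i. int e dvd p i) \<longrightarrow> e = 1")
          case True
          then have "y \<in> near_reduced q \<delta>" using p by (auto simp: near_reduced_def)
          with y show ?thesis by (auto simp: B_def mem_box_cart)
        next
          case False
          then obtain e where e: "e dvd q" "\<And>i. int e dvd p i" "e \<noteq> 1" by blast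
          with elim have "e > 0" by (cases "e = 0") auto
          have "e \<le> q" using e elim by (auto intro: dvd_imp_le)
          with e \<open>e > 0\<close> have "e \<in> E" by (auto simp: E_def)
          moreover have "y $ i \<in> near_ints (q div e) (\<delta> / e)" for i
          proof -
            have "real (q div e) * y $ i - of_int (p i div int e) = (q * y $ i - p i) / e"
              using e by (simp add: real_of_nat_div real_of_int_div diff_divide_distrib)
            then have "\<bar>real (q div e) * y $ i - of_int (p i div int e)\<bar> < \<delta> / e"
              using p[of i] \<open>e > 0\<close> by (simp add: abs_divide divide_strict_right_mono)
            then show ?thesis by (auto simp: near_ints_def)
          qed
          ultimately show ?thesis using y by (auto simp: B_def)
        qed
      qed
      have E: "finite E" by (simp add: E_def)
      have "measure lborel (B q \<delta>) \<le> measure lborel ((near_reduced q \<delta> \<inter> cbox l u) \<union> (\<Union>e\<in>E. B (q div e) (\<delta> / e)))"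
        using Bborel Bfin Afin E by (intro measure_mono_fmeasurable sub fmeasurable.Un fmeasurable.finite_UN) auto
      also have "\<dots> \<le> measure lborel (near_reduced q \<delta> \<inter> cbox l u) + measure lborel (\<Union>e\<in>E. B (q div e) (\<delta> / e))"
        using Bborel E by (intro measure_Un_le) auto
      also have "measure lborel (\<Union>e\<in>E. B (q div e) (\<delta> / e)) \<le> (\<Sum>e\<in>E. measure lborel (B (q div e) (\<delta> / e)))"
        using Bborel E by (intro measure_UNION_le) auto
      finally have main: "measure lborel (B q \<delta>) \<le> measure lborel (near_reduced q \<delta> \<inter> cbox l u)
        + (\<Sum>e\<in>E. measure lborel (B (q div e) (\<delta> / e)))" by simp
      have bdry: "4 * \<delta> / q \<le> 2 * \<delta> * (u $ i - l $ i) * k q" for i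
      proof -
        have "4 * \<delta> / q = 2 * \<delta> * s * k q" using \<open>s > 0\<close> elim by (simp add: k_def field_simps)
        also have "\<dots> \<le> 2 * \<delta> * (u $ i - l $ i) * k q"
          using s[of i] \<delta> \<open>s > 0\<close> by (intro mult_right_mono mult_left_mono) (auto simp: k_def)
        finally show ?thesis .
      qed
      have kpos: "k q \<ge> 0" using \<open>s > 0\<close> by (simp add: k_def)
      have prodV: "(\<Prod>i\<in>UNIV. 2 * \<delta> * (u $ i - l $ i) * c) = (2 * \<delta>) ^ CARD('n) * V * c ^ CARD('n)" for c
        by (simp add: prod.distrib V_def)
      have low: "(2 * \<delta>) ^ CARD('n) * V * (1 - k q) ^ CARD('n) \<le> measure lborel (B q \<delta>)"
        unfolding prodV[symmetric] B
      proof (intro prod_mono conjI)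
        fix i
        show "0 \<le> 2 * \<delta> * (u $ i - l $ i) * (1 - k q)" using \<delta> lu[of i] elim by auto
        have "2 * \<delta> * (u $ i - l $ i) * (1 - k q) \<le> 2 * \<delta> * (u $ i - l $ i) - 4 * \<delta> / q"
          using bdry[of i] by (simp add: right_diff_distrib)
        also have "\<dots> \<le> measure lborel (near_ints q \<delta> \<inter> {l $ i..u $ i})"
          using elim \<delta> by (intro measure_near_ints_ge) auto
        finally show "2 * \<delta> * (u $ i - l $ i) * (1 - k q) \<le> measure lborel (near_ints q \<delta> \<inter> {l $ i..u $ i})" .
      qed
      have up: "measure lborel (B (q div e) (\<delta> / e))
          \<le> (2 * \<delta>) ^ CARD('n) * V * (11/10 * (1 / (real e)\<^sup>2) + 11 * (k q)\<^sup>2)" if "e \<in> E" for e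
      proof -
        have e: "e \<ge> 2" "e dvd q" "e \<le> q" using that by (auto simp: E_def)
        have "measure lborel (B (q div e) (\<delta> / e)) \<le> (2 * \<delta>) ^ CARD('n) * V * (1 / e + k q) ^ CARD('n)"
          unfolding prodV[symmetric] B
        proof (intro prod_mono conjI)
          fix i
          have "measure lborel (near_ints (q div e) (\<delta> / e) \<inter> {l $ i..u $ i})
            \<le> 2 * (\<delta> / e) * (u $ i - l $ i) + 4 * (\<delta> / e) / (q div e)"
            using e \<delta> lu[of i] elim
            by (intro measure_near_ints_le) (auto simp: Suc_le_eq div_greater_zero_iff field_simps intro: order_trans[of _ 1])
          \<comment> \<open>The boundary term does not shrink with \<open>e\<close>, so its total
            over the divisors needs separate care.\<close>
          also have "4 * (\<delta> / e) / real (q div e) = 4 * \<delta> / q"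
            using e by (simp add: real_of_nat_div)
          also have "2 * (\<delta> / e) * (u $ i - l $ i) + \<dots> \<le> 2 * \<delta> * (u $ i - l $ i) * (1 / e + k q)"
            using bdry[of i] by (simp add: distrib_left)
          finally show "measure lborel (near_ints (q div e) (\<delta> / e) \<inter> {l $ i..u $ i})
            \<le> 2 * \<delta> * (u $ i - l $ i) * (1 / e + k q)" .
        qed simp
        \<comment> \<open>The base is at most 1 because \<open>e \<ge> 2\<close> and
          \<open>k q < 1/2\<close>, so the exponent may drop to 2. Here dimension at least 2
          enters.\<close>
        also have "(1 / e + k q) ^ CARD('n) \<le> (1 / e + k q)\<^sup>2"
        proof (rule power_decreasing[OF card])
          have "1 / real e \<le> 1 / 2" using e by (intro divide_left_mono) auto
          then show "1 / e + k q \<le> 1" using elim by linarith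
        qed (use kpos in auto)
        also have "(1 / e + k q)\<^sup>2 \<le> 11/10 * (1 / e)\<^sup>2 + 11 * (k q)\<^sup>2"
        proof -
          \<comment> \<open>A weighted AM-GM: the cross term \<open>2 * k q / e\<close> is at most a
            tenth of \<open>1 / e^2\<close> plus \<open>10 * (k q)^2\<close>.\<close>
          have "0 \<le> (1 / real e - 10 * k q)\<^sup>2" by simp
          also have "\<dots> = (1/e)\<^sup>2 - 20 * (1/e) * k q + 100 * (k q)\<^sup>2"
            by (simp add: power2_diff power_mult_distrib)
          finally show ?thesis by (simp add: power2_sum)
        qed
        finally show ?thesis using \<delta> V by (simp add: power_divide mult_left_mono)
      qed
      have "(\<Sum>e\<in>E. measure lborel (B (q div e) (\<delta> / e)))
         \<le> (\<Sum>e\<in>E. (2 * \<delta>) ^ CARD('n) * V * (11/10 * (1 / (real e)\<^sup>2) + 11 * (k q)\<^sup>2))"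
        by (intro sum_mono up)
      \<comment> \<open>Even over all of \<open>{2..q}\<close> there are fewer than \<open>q\<close>
        error terms \<open>11 * (k q)^2\<close>, each of order \<open>1 / q^2\<close>; their total
        still tends to 0.\<close>
      also have "\<dots> \<le> (\<Sum>e=2..q. (2 * \<delta>) ^ CARD('n) * V * (11/10 * (1 / (real e)\<^sup>2) + 11 * (k q)\<^sup>2))"
        using \<delta> V by (intro sum_mono2) (auto simp: E_def)
      also have "\<dots> = (2 * \<delta>) ^ CARD('n) * V * (11/10 * (\<Sum>e=2..q. 1 / (real e)\<^sup>2) + 11 * (q - 1) * (k q)\<^sup>2)"
        unfolding sum_distrib_left[symmetric] sum.distrib using elim by simp
      also have "\<dots> \<le> (2 * \<delta>) ^ CARD('n) * V * (11/10 * (3/4) + 44 / s\<^sup>2 / q)"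
      proof -
        have "(\<Sum>e=2..q. 1 / (real e)\<^sup>2) \<le> 3/4"
          using sum_inverse_squares_le[of q] elim by (smt (verit) of_nat_0_le_iff zero_le_divide_1_iff)
        moreover have "11 * (real q - 1) * (k q)\<^sup>2 \<le> 11 * real q * (k q)\<^sup>2"
          by (intro mult_right_mono) auto
        moreover have "11 * real q * (k q)\<^sup>2 = 44 / s\<^sup>2 / q"
          using elim \<open>s > 0\<close> by (simp add: k_def field_simps power2_eq_square)
        ultimately show ?thesis
          using \<delta> V elim by (intro mult_left_mono) auto
      qed
      finally have "measure lborel (near_reduced q \<delta> \<inter> cbox l u) \<ge> (2 * \<delta>) ^ CARD('n) * V * (1 - k q) ^ CARD('n)
         - (2 * \<delta>) ^ CARD('n) * V * (11/10 * (3/4) + 44 / s\<^sup>2 / q)"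
        using main low by linarith
      also have "(2 * \<delta>) ^ CARD('n) * V * (1 - k q) ^ CARD('n)
         - (2 * \<delta>) ^ CARD('n) * V * (11/10 * (3/4) + 44 / s\<^sup>2 / q)
         = (2 * \<delta>) ^ CARD('n) * V * ((1 - k q) ^ CARD('n) - 44 / s\<^sup>2 / q - 33/40)"
        by (simp add: algebra_simps)
      also have "\<dots> \<ge> (2 * \<delta>) ^ CARD('n) * V * (1/10)"
        using elim \<delta> V by (intro mult_left_mono) auto
      also have "(2 * \<delta>) ^ CARD('n) * V * (1/10) \<ge> \<delta> ^ CARD('n) * V * (1/10)"
        using \<delta> V by (intro mult_right_mono power_mono) auto
      finally show "measure lborel (near_reduced q \<delta> \<inter> cbox l u)
        \<ge> 1/10 * \<delta> ^ CARD('n) * measure lborel (cbox l u)" by (simp add: Veq mult_ac)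
    qed
  qed
qed

section \<open>A divergence Borel--Cantelli lemma and Gallagher's theorem\<close>

text \<open>With \<open>X\<close> the number of sets \<open>B q\<close> containing a point,
  integrate \<open>X * 1_E \<le> t/2 * 1_E + X^2 / (2 * t)\<close>. Optimised over \<open>t\<close>,
  this is the Cauchy-Schwarz inequality.\<close>

lemma sum_measure_Int_le_second_moment:
  fixes B :: "'i \<Rightarrow> 'a set" and t :: real
  assumes I: "finite I" and B: "\<And>q. q \<in> I \<Longrightarrow> B q \<in> fmeasurable M" and E: "E \<in> fmeasurable M" and "t > 0"
  shows "(\<Sum>q\<in>I. measure M (B q \<inter> E))
    \<le> t / 2 * measure M E + (\<Sum>q\<in>I. \<Sum>r\<in>I. measure M (B q \<inter> B r)) / (2 * t)"
proof -
  let ?X = "\<lambda>x. \<Sum>q\<in>I. indicator (B q) x :: real"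
  let ?f = "\<lambda>x. \<Sum>q\<in>I. indicator (B q \<inter> E) x :: real"
  let ?g = "\<lambda>x. t / 2 * indicator E x + (\<Sum>q\<in>I. \<Sum>r\<in>I. indicator (B q \<inter> B r) x) / (2 * t) :: real"
  have int: "integrable M (indicator S :: _ \<Rightarrow> real)" if "S \<in> fmeasurable M" for S
    using that by (intro integrable_real_indicator) (auto simp: fmeasurable_def)
  have "integral\<^sup>L M ?f \<le> integral\<^sup>L M ?g"
  proof (rule integral_mono)
    show "integrable M ?f" using B E by (intro Bochner_Integration.integrable_sum int fmeasurable.Int)
    show "integrable M ?g"
      using B E by (intro Bochner_Integration.integrable_sum Bochner_Integration.integrable_add
          integrable_mult_right integrable_divide int fmeasurable.Int)
    fix x
    have g: "?g x = t / 2 * indicator E x + (?X x)\<^sup>2 / (2 * t)"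
      by (simp add: power2_eq_square sum_product indicator_inter_arith)
    have f: "?f x = ?X x * indicator E x"
      by (simp add: sum_distrib_right indicator_inter_arith)
    have "0 \<le> (?X x - t)\<^sup>2" by simp
    then have "2 * t * ?X x \<le> t\<^sup>2 + (?X x)\<^sup>2" by (simp add: power2_diff mult_ac)
    then have "?X x \<le> t / 2 + (?X x)\<^sup>2 / (2 * t)"
      using \<open>t > 0\<close> by (simp add: field_simps power2_eq_square)
    moreover have "0 \<le> (?X x)\<^sup>2 / (2 * t)" using \<open>t > 0\<close> by simp
    ultimately show "?f x \<le> ?g x" unfolding f g by (simp add: indicator_def)
  qed
  also have "integral\<^sup>L M ?f = (\<Sum>q\<in>I. measure M (B q \<inter> E))"
    using B E by (subst Bochner_Integration.integral_sum) (auto intro!: int fmeasurable.Int sum.cong arg_cong2[where f = measure] dest: fmeasurableD sets.sets_into_space)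
  also have "integral\<^sup>L M ?g = t / 2 * measure M E + (\<Sum>q\<in>I. \<Sum>r\<in>I. measure M (B q \<inter> B r)) / (2 * t)"
  proof -
    have sp: "measure M (S \<inter> space M) = measure M S" if "S \<in> fmeasurable M" for S
      using that by (auto intro!: arg_cong2[where f = measure] dest!: fmeasurableD sets.sets_into_space)
    have "integral\<^sup>L M ?g = t / 2 * measure M (E \<inter> space M)
      + (\<Sum>q\<in>I. \<Sum>r\<in>I. measure M (B q \<inter> B r \<inter> space M)) / (2 * t)"
      using B E
      by (subst Bochner_Integration.integral_add)
        (auto intro!: Bochner_Integration.integrable_sum int fmeasurable.Int
          simp: Bochner_Integration.integral_sum int fmeasurable.Int)
    also have "\<dots> = t / 2 * measure M E + (\<Sum>q\<in>I. \<Sum>r\<in>I. measure M (B q \<inter> B r)) / (2 * t)"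
      using B E by (simp add: sp fmeasurable.Int)
    finally show ?thesis .
  qed
  finally show ?thesis .
qed

text \<open>A positive-measure set \<open>F\<close> avoiding almost all \<open>A q\<close> could be covered by boxes with little
  excess. By the local bound the \<open>A q\<close> fill a fixed proportion of these boxes, hence they pile up
  on the small excess, which the second moment bound forbids.\<close>

lemma negligible_finitely_often:
  fixes A :: "nat \<Rightarrow> 'a::euclidean_space set" and w :: "nat \<Rightarrow> real" and c C :: real
  assumes A: "\<And>q. A q \<in> sets borel"
    and w: "\<And>q. 0 \<le> w q" "\<not> summable w"
    and "C > 0" "c > 0"
    and single: "\<And>q. q \<ge> 1 \<Longrightarrow> measure lborel (A q \<inter> cbox a b) \<le> C * w q"
    and pair: "\<And>q r. q \<ge> 1 \<Longrightarrow> r \<ge> 1 \<Longrightarrow> q \<noteq> r \<Longrightarrow>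
        measure lborel (A q \<inter> A r \<inter> cbox a b) \<le> C * w q * w r"
    and dense: "\<And>l u. cbox l u \<subseteq> cbox a b \<Longrightarrow> \<forall>\<^sub>F q in sequentially.
        c * w q * measure lborel (cbox l u) \<le> measure lborel (A q \<inter> cbox l u)"
  shows "negligible {y \<in> cbox a b. finite {q. y \<in> A q}}"
proof -
  \<comment> \<open>The exceptional points lie in the countable union of these sets, so it suffices
    that each is negligible.\<close>
  define F where "F m = cbox a b - (\<Union>q\<in>{m..}. A q)" for m
  have Fborel: "F m \<in> sets borel" for m unfolding F_def using A by auto
  have lebeq: "measure lebesgue S = measure lborel S" if "S \<in> sets borel" for S :: "'a set"
    using that by simp
  have Fneg: "negligible (F m)" if "m \<ge> 1" for m
  proof -
    have Fsub: "F m \<subseteq> cbox a b" by (auto simp: F_def)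
    have Fmeas: "F m \<in> lmeasurable"
      by (rule fmeasurableI2[OF lmeasurable_cbox Fsub]) (use Fborel[of m] in simp)
    define f where "f = measure lebesgue (F m)"
    have "f = 0"
    proof (rule ccontr)
      assume "f \<noteq> 0"
      then have f: "f > 0" by (simp add: f_def zero_less_measure_iff)
      \<comment> \<open>The choices make \<open>\<Lambda> * \<eta> / 2\<close> and
        \<open>C / \<Lambda>\<close> both equal \<open>c * f / 8\<close>. Their sum
        \<open>c * f / 4\<close> then contradicts the lower bound \<open>c * f / 2\<close>.\<close>
      define \<Lambda> where "\<Lambda> = 8 * C / (c * f)"
      define \<eta> where "\<eta> = c * f / (4 * \<Lambda>)"
      have pos: "\<Lambda> > 0" "\<eta> > 0" using f \<open>C > 0\<close> \<open>c > 0\<close> by (simp_all add: \<Lambda>_def \<eta>_def)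
      obtain \<D> where \<D>: "countable \<D>"
        "\<And>K. K \<in> \<D> \<Longrightarrow> K \<subseteq> cbox a b \<and> K \<noteq> {} \<and> (\<exists>c d. K = cbox c d)"
        "pairwise (\<lambda>A B. interior A \<inter> interior B = {}) \<D>"
        "F m \<subseteq> \<Union>\<D>" "\<Union>\<D> \<in> lmeasurable" "measure lebesgue (\<Union>\<D>) \<le> f + \<eta>"
      proof (rule measurable_outer_intervals_bounded[OF Fmeas Fsub pos(2)], goal_cases)
        case (1 \<D>)
        show thesis by (rule 1(1)) (fact 1(2,3,4,7,8) 1(9)[folded f_def])+
      qed
      have \<D>meas: "K \<in> lmeasurable" if "K \<in> \<D>" for K
        using \<D>(2)[OF that] by auto
      \<comment> \<open>A finite subfamily lets the local bounds hold for all its boxes from one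
        index on, and still keeps measure above \<open>f / 2\<close>.\<close>
      obtain \<D>' where \<D>': "\<D>' \<subseteq> \<D>" "finite \<D>'" "measure lebesgue (\<Union>\<D>) - f / 2 < measure lebesgue (\<Union>\<D>')"
      proof (rule measure_countable_Union_approachable[OF \<D>(1) _ \<D>meas, of "f / 2"])
        show "measure lebesgue (\<Union>D') \<le> measure lebesgue (\<Union>\<D>)" if "D' \<subseteq> \<D>" "finite D'" for D'
        proof (rule measure_mono_fmeasurable[OF _ _ \<D>(5)])
          show "\<Union>D' \<in> sets lebesgue"
            using that \<D>meas by (intro sets.finite_Union subsetI) (auto dest!: fmeasurableD)
        qed (use that in auto)
      qed (use f in auto)
      define D where "D = \<Union>\<D>'"
      have box: "K \<subseteq> cbox a b \<and> (\<exists>l u. K = cbox l u)" if "K \<in> \<D>'" for K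
        using that \<D>(2) \<D>'(1) by blast
      have Kborel: "K \<in> sets borel" if "K \<in> \<D>'" for K
        using box[OF that] by auto
      have Dborel: "D \<in> sets borel" unfolding D_def using \<D>'(2) Kborel by auto
      have Dsub: "D \<subseteq> cbox a b" unfolding D_def using box by blast
      have Dmeas: "measure lborel D > f / 2"
      proof -
        have "f \<le> measure lebesgue (\<Union>\<D>)"
          unfolding f_def using \<D> Fmeas by (intro measure_mono_fmeasurable) auto
        then show ?thesis using \<D>'(3) lebeq[OF Dborel] unfolding D_def by linarith
      qed
      have finbox: "S \<in> fmeasurable lborel" if "S \<in> sets borel" "S \<subseteq> cbox a b" for S
        using that by (intro fmeasurableI2[OF fmeasurable_cbox, of S a b]) auto
      have DF: "measure lborel (D - F m) \<le> \<eta>"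
      proof -
        have "measure lborel (D - F m) = measure lebesgue (D - F m)"
          using Dborel Fborel by (intro lebeq[symmetric]) auto
        also have "\<dots> \<le> measure lebesgue (\<Union>\<D> - F m)"
          using Dborel Fborel \<D>(5) Fmeas \<D>'(1)
          by (intro measure_mono_fmeasurable fmeasurable.Diff) (auto simp: D_def)
        also have "\<dots> = measure lebesgue (\<Union>\<D>) - f"
          unfolding f_def using \<D> Fmeas by (intro measurable_measure_Diff) auto
        also have "\<dots> \<le> \<eta>" using \<D>(6) by simp
        finally show ?thesis .
      qed
      have "\<forall>\<^sub>F q in sequentially. \<forall>K\<in>\<D>'. c * w q * measure lborel K \<le> measure lborel (A q \<inter> K)"
        using \<D>'(2)
      proof (rule eventually_ball_finite, intro ballI)
        fix K assume "K \<in> \<D>'"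
        with box obtain l u where "K = cbox l u" "cbox l u \<subseteq> cbox a b" by metis
        with dense show "\<forall>\<^sub>F q in sequentially. c * w q * measure lborel K \<le> measure lborel (A q \<inter> K)" by simp
      qed
      then obtain n where n: "\<And>q K. q \<ge> n \<Longrightarrow> K \<in> \<D>' \<Longrightarrow> c * w q * measure lborel K \<le> measure lborel (A q \<inter> K)"
        unfolding eventually_sequentially by blast
      define n1 where "n1 = max n m"
      \<comment> \<open>A total weight \<open>S > 1\<close> lets the diagonal part
        \<open>C * S\<close> of the second moment be absorbed into \<open>C * S * S\<close>.\<close>
      obtain N where N: "(\<Sum>q\<in>{n1..<N+n1}. w q) > 1"
      proof -
        have "\<not> summable (\<lambda>q. w (q + n1))" using w(2) by simp
        then have "\<not> (\<forall>N. (\<Sum>q<N. w (q + n1)) \<le> 1)"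
          using w(1) summableI_nonneg_bounded[of "\<lambda>q. w (q + n1)" 1] by blast
        then obtain N where "(\<Sum>q<N. w (q + n1)) > 1" by (auto simp: not_le)
        also have "(\<Sum>q<N. w (q + n1)) = (\<Sum>q\<in>{n1..<N+n1}. w q)"
          using sum.shift_bounds_nat_ivl[of w 0 n1 N] by (simp only: atLeast0LessThan add_0)
        finally show ?thesis using that by blast
      qed
      define I where "I = {n1..<N+n1}"
      define S where "S = (\<Sum>q\<in>I. w q)"
      have S: "S > 1" using N by (simp add: S_def I_def)
      have I: "q \<ge> n" "q \<ge> m" "q \<ge> 1" if "q \<in> I" for q
        using that \<open>m \<ge> 1\<close> by (auto simp: I_def n1_def)
      \<comment> \<open>For \<open>q \<ge> m\<close> the set \<open>A q\<close> misses
        \<open>F m\<close>, so whatever it fills of \<open>D\<close> lies in the small excess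
        \<open>D - F m\<close>. The boxes overlap only in null sets, so their bounds add up.\<close>
      have ge: "c * w q * measure lborel D \<le> measure lborel (A q \<inter> cbox a b \<inter> (D - F m))" if q: "q \<in> I" for q
      proof -
        have neg: "negligible (K \<inter> L)" if "K \<in> \<D>'" "L \<in> \<D>'" "K \<noteq> L" for K L
        proof -
          have "interior K \<inter> interior L = {}"
            using that \<D>(3) \<D>'(1) by (auto simp: pairwise_def)
          moreover have "convex (K \<inter> L)" using box[OF that(1)] box[OF that(2)] by (auto intro!: convex_Int)
          ultimately show ?thesis by (simp add: negligible_convex_interior)
        qed
        have lm: "K \<in> lmeasurable" "A q \<inter> K \<in> lmeasurable" if "K \<in> \<D>'" for K
          using box[OF that] A[of q] by (auto intro!: fmeasurableI2[OF lmeasurable_cbox])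
        have "measure lebesgue D = (\<Sum>K\<in>\<D>'. measure lebesgue K)"
          unfolding D_def using \<D>'(2) lm neg
          by (intro measure_negligible_finite_Union) (auto simp: pairwise_def)
        then have "c * w q * measure lborel D = (\<Sum>K\<in>\<D>'. c * w q * measure lborel K)"
          using lebeq Dborel Kborel by (simp add: sum_distrib_left)
        also have "\<dots> \<le> (\<Sum>K\<in>\<D>'. measure lborel (A q \<inter> K))"
          using I q n by (intro sum_mono) auto
        also have "\<dots> = (\<Sum>K\<in>\<D>'. measure lebesgue (A q \<inter> K))"
          using Kborel A by (intro sum.cong refl lebeq[symmetric]) auto
        also have "\<dots> = measure lebesgue (\<Union>K\<in>\<D>'. A q \<inter> K)"
          using \<D>'(2) lm
          by (intro measure_negligible_finite_Union_image[symmetric])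
            (auto simp: pairwise_def intro: negligible_subset[OF neg])
        also have "(\<Union>K\<in>\<D>'. A q \<inter> K) = A q \<inter> D" by (auto simp: D_def)
        also have "\<dots> = A q \<inter> cbox a b \<inter> (D - F m)" using Dsub I[OF q] by (auto simp: F_def)
        also have "measure lebesgue \<dots> = measure lborel \<dots>"
          using A Dborel Fborel by (intro lebeq) auto
        finally show ?thesis .
      qed
      have "c * measure lborel D * S = (\<Sum>q\<in>I. c * w q * measure lborel D)"
        by (simp add: S_def sum_distrib_left sum_distrib_right mult_ac)
      also have "\<dots> \<le> (\<Sum>q\<in>I. measure lborel (A q \<inter> cbox a b \<inter> (D - F m)))"
        by (intro sum_mono ge)
      \<comment> \<open>Taking \<open>t = \<Lambda> * S\<close> makes both terms grow linearly in
        \<open>S\<close>, so that \<open>S\<close> cancels at the end.\<close>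
      also have "\<dots> \<le> \<Lambda> * S / 2 * measure lborel (D - F m)
         + (\<Sum>q\<in>I. \<Sum>r\<in>I. measure lborel (A q \<inter> cbox a b \<inter> (A r \<inter> cbox a b))) / (2 * (\<Lambda> * S))"
        using pos S A Dborel Fborel Dsub
        by (intro sum_measure_Int_le_second_moment finbox) (auto simp: I_def)
      also have "\<dots> \<le> \<Lambda> * S / 2 * \<eta> + (2 * C * S * S) / (2 * (\<Lambda> * S))"
      proof (intro add_mono mult_left_mono divide_right_mono DF)
        have "(\<Sum>q\<in>I. \<Sum>r\<in>I. measure lborel (A q \<inter> cbox a b \<inter> (A r \<inter> cbox a b)))
          \<le> (\<Sum>q\<in>I. \<Sum>r\<in>I. C * w q * w r + (if r = q then C * w q else 0))"
        proof (intro sum_mono)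
          fix q r assume qr: "q \<in> I" "r \<in> I"
          have eq: "A q \<inter> cbox a b \<inter> (A r \<inter> cbox a b) = A q \<inter> A r \<inter> cbox a b" by blast
          have "0 \<le> C * w q * w r" using w(1) \<open>C > 0\<close> by simp
          then show "measure lborel (A q \<inter> cbox a b \<inter> (A r \<inter> cbox a b))
              \<le> C * w q * w r + (if r = q then C * w q else 0)"
            unfolding eq using pair[OF I(3) I(3), OF qr] single[OF I(3), OF qr(1)] by (cases "r = q") auto
        qed
        also have "\<dots> = C * S * S + C * S"
        proof -
          have "(\<Sum>q\<in>I. \<Sum>r\<in>I. C * w q * w r) = C * S * S"
          proof -
            have "S * S = (\<Sum>q\<in>I. \<Sum>r\<in>I. w q * w r)" unfolding S_def by (rule sum_product)
            then show ?thesis by (simp only: mult.assoc sum_distrib_left)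
          qed
          moreover have "(\<Sum>q\<in>I. \<Sum>r\<in>I. if r = q then C * w q else 0) = C * S"
          proof -
            have "finite I" by (simp add: I_def)
            then show ?thesis unfolding S_def sum_distrib_left by simp
          qed
          ultimately show ?thesis by (simp add: sum.distrib)
        qed
        also have "\<dots> \<le> 2 * C * S * S" using S \<open>C > 0\<close> by simp
        finally show "(\<Sum>q\<in>I. \<Sum>r\<in>I. measure lborel (A q \<inter> cbox a b \<inter> (A r \<inter> cbox a b))) \<le> 2 * C * S * S" .
      qed (use pos S in auto)
      also have "\<dots> = (\<Lambda> * \<eta> / 2 + C / \<Lambda>) * S"
        using pos S by (simp add: field_simps)
      finally have "c * measure lborel D \<le> \<Lambda> * \<eta> / 2 + C / \<Lambda>"
        using S by simp
      also have "\<dots> = c * f / 4"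
        using pos f \<open>C > 0\<close> \<open>c > 0\<close> by (simp add: \<eta>_def) (simp add: \<Lambda>_def)
      finally have "c * measure lborel D \<le> c * f / 4" .
      moreover have "c * f / 4 < c * (f / 2)" using f \<open>c > 0\<close> by simp
      moreover have "c * (f / 2) < c * measure lborel D" using Dmeas \<open>c > 0\<close> by simp
      ultimately show False by linarith
    qed
    then show ?thesis using Fmeas by (simp add: negligible_iff_measure f_def)
  qed
  have "{y \<in> cbox a b. finite {q. y \<in> A q}} \<subseteq> (\<Union>m. F (Suc m))"
  proof clarify
    fix y assume y: "y \<in> cbox a b" "finite {q. y \<in> A q}"
    then obtain m where "\<forall>q\<in>{q. y \<in> A q}. q < m" using finite_nat_set_iff_bounded by blast
    then have "y \<in> F (Suc m)" using y by (force simp: F_def)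
    then show "y \<in> (\<Union>m. F (Suc m))" by blast
  qed
  moreover have "negligible (\<Union>m. F (Suc m))"
    using Fneg by (intro negligible_countable_Union) auto
  ultimately show ?thesis by (rule negligible_subset[rotated])
qed

text \<open>Passing to reduced fractions only removes solutions, so the unit cube is handled by
  \<open>negligible_finitely_often\<close>; periodicity under integer translations extends this to
  the whole space.\<close>

theorem gallagher_khintchine:
  fixes a :: "nat \<Rightarrow> real"
  assumes card: "CARD('n::finite) \<ge> 2"
    and a: "\<And>q. 0 \<le> a q" "\<And>q. a q \<le> 1/2"
    and diverges: "\<not> summable (\<lambda>q. a q ^ CARD('n))"
  shows "AE y in (lebesgue :: (real^'n) measure).
    infinite {q. \<exists>p :: 'n \<Rightarrow> int. \<forall>i. \<bar>real q * y $ i - p i\<bar> < a q}"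
proof -
  define G where "G y = {q. \<exists>p :: 'n \<Rightarrow> int. \<forall>i. \<bar>real q * y $ i - p i\<bar> < a q}" for y :: "real^'n"
  let ?A = "\<lambda>q. near_reduced q (a q) :: (real^'n) set"
  have "negligible {y \<in> cbox 0 1 :: (real^'n) set. finite {q. y \<in> ?A q}}"
  proof (rule negligible_finitely_often[where w = "\<lambda>q. a q ^ CARD('n)" and C = "24 ^ CARD('n)" and c = "1/10"])
    fix l u :: "real^'n"
    show "\<forall>\<^sub>F q in sequentially. 1/10 * a q ^ CARD('n) * measure lborel (cbox l u)
        \<le> measure lborel (?A q \<inter> cbox l u)"
    proof (cases "\<forall>i. l $ i < u $ i")
      case True
      then show ?thesis
        using measure_near_reduced_ge[OF card, of l u] a by (auto elim!: eventually_mono)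
    next
      case False
      then have "measure lborel (cbox l u) = 0"
        by (auto simp: content_eq_0 Basis_vec_def inner_axis not_less)
      then show ?thesis by simp
    qed
  qed (use a diverges in \<open>auto intro!: measure_near_reduced_le measure_near_reduced_pair_le\<close>)
  then have neg: "negligible {y \<in> cbox 0 1. finite (G y)}"
    by (rule negligible_subset)
       (auto simp: G_def near_reduced_def elim!: finite_subset[rotated])
  define h :: "('n \<Rightarrow> int) \<Rightarrow> real^'n" where "h f = (\<chi> i. of_int (f i))" for f
  \<comment> \<open>An integer shift of the point is absorbed by the numerators
    \<open>p\<close>.\<close>
  have Gh: "G (y - h f) = G y" for y f
  proof -
    have "(\<exists>p :: 'n \<Rightarrow> int. \<forall>i. \<bar>real q * (y - h f) $ i - p i\<bar> < a q) \<longleftrightarrow>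
      (\<exists>p :: 'n \<Rightarrow> int. \<forall>i. \<bar>real q * y $ i - p i\<bar> < a q)" for q
    proof safe
      fix p :: "'n \<Rightarrow> int" assume "\<forall>i. \<bar>real q * (y - h f) $ i - p i\<bar> < a q"
      then show "\<exists>p :: 'n \<Rightarrow> int. \<forall>i. \<bar>real q * y $ i - p i\<bar> < a q"
        by (intro exI[of _ "\<lambda>i. p i + int q * f i"]) (simp add: h_def algebra_simps)
    next
      fix p :: "'n \<Rightarrow> int" assume "\<forall>i. \<bar>real q * y $ i - p i\<bar> < a q"
      then show "\<exists>p :: 'n \<Rightarrow> int. \<forall>i. \<bar>real q * (y - h f) $ i - p i\<bar> < a q"
        by (intro exI[of _ "\<lambda>i. p i - int q * f i"]) (simp add: h_def algebra_simps)
    qed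
    then show ?thesis by (simp add: G_def)
  qed
  have "{y. finite (G y)} \<subseteq> (\<Union>f. (+) (h f) ` {y \<in> cbox 0 1. finite (G y)})"
  proof
    fix y assume "y \<in> {y. finite (G y)}"
    define f where "f = (\<lambda>i. \<lfloor>y $ i\<rfloor>)"
    have "y - h f \<in> cbox 0 1"
      by (auto simp: mem_box_cart h_def f_def) linarith
    with \<open>y \<in> _\<close> have "y - h f \<in> {y \<in> cbox 0 1. finite (G y)}" by (simp add: Gh)
    then show "y \<in> (\<Union>f. (+) (h f) ` {y \<in> cbox 0 1. finite (G y)})"
      by (intro UN_I[of f] image_eqI[of _ _ "y - h f"]) auto
  qed
  moreover have "negligible (\<Union>f. (+) (h f) ` {y \<in> cbox 0 1. finite (G y)})"
  proof -
    have "countable (range (\<lambda>f. (+) (h f) ` {y \<in> cbox 0 1. finite (G y)}))"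
      by (intro countable_image countableI_type)
    moreover have "negligible T" if "T \<in> range (\<lambda>f. (+) (h f) ` {y \<in> cbox 0 1. finite (G y)})" for T
      using that negligible_translation[OF neg] by auto
    ultimately show ?thesis by (rule negligible_countable_Union)
  qed
  ultimately have "negligible {y. finite (G y)}" by (rule negligible_subset[rotated])
  then have "{y. finite (G y)} \<in> null_sets lebesgue" by (simp add: negligible_iff_null_sets)
  then have "AE y in lebesgue. y \<notin> {y. finite (G y)}" by (rule AE_not_in)
  then show ?thesis by (simp add: G_def)
qed

section \<open>Divergence along the fibre\<close>

text \<open>Dirichlet's pigeonhole argument with counting: differences of indices whose multiples
  share a cell are good, so a cell holds at most \<open>card G + 1\<close> of the
  \<open>N + 1\<close> multiples.\<close>

lemma card_near_integer_multiples_ge: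
  fixes x \<delta> :: real and N :: nat
  assumes "0 < \<delta>" "\<delta> \<le> 1"
  shows "real (card {q \<in> {1..N}. \<exists>p::int. \<bar>real q * x - p\<bar> < \<delta>}) \<ge> N * \<delta> / 2 - 1"
proof -
  define G where "G = {q \<in> {1..N}. \<exists>p::int. \<bar>real q * x - p\<bar> < \<delta>}"
  \<comment> \<open>The cells have length \<open>1 / m \<le> \<delta>\<close>; rounding up gives
    \<open>m \<le> 2 / \<delta>\<close>, which costs the factor 1/2 in the result.\<close>
  define m where "m = nat \<lceil>1 / \<delta>\<rceil>"
  have m: "m \<ge> 1" "1 / \<delta> \<le> m" "m \<le> 2 / \<delta>"
  proof -
    have "1 / \<delta> \<ge> 1" using assms by simp
    moreover have "2 / \<delta> = 1 / \<delta> + 1 / \<delta>" by simp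
    ultimately show "m \<ge> 1" "1 / \<delta> \<le> m" "m \<le> 2 / \<delta>" unfolding m_def by linarith+
  qed
  define b where "b j = nat \<lfloor>m * frac (real j * x)\<rfloor>" for j
  have b: "b j < m" for j
  proof -
    have "m * frac (real j * x) < real m * 1"
      using m(1) by (intro mult_strict_left_mono) (auto simp: frac_lt_1)
    then show ?thesis using m(1) by (simp add: b_def nat_less_iff floor_less_iff)
  qed
  define B where "B i = {j \<in> {0..N}. b j = i}" for i
  have card_B: "card (B i) \<le> card G + 1" for i
  proof (cases "B i = {}")
    case False
    have fin: "finite (B i)" by (simp add: B_def)
    define j0 where "j0 = Min (B i)"
    have j0: "j0 \<in> B i" "\<And>j. j \<in> B i \<Longrightarrow> j0 \<le> j" using False fin by (auto simp: j0_def)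
    \<comment> \<open>Subtracting the least index of the cell is injective; 0 accounts for
      \<open>j0\<close> itself.\<close>
    have "(\<lambda>j. j - j0) ` B i \<subseteq> insert 0 G"
    proof (rule image_subsetI)
      fix j assume j: "j \<in> B i"
      show "j - j0 \<in> insert 0 G"
      proof (cases "j = j0")
        case False
        let ?f = "\<lambda>j. frac (real j * x)"
        have "\<lfloor>m * ?f j\<rfloor> = \<lfloor>m * ?f j0\<rfloor>"
          using j j0(1) eq_nat_nat_iff[of "\<lfloor>m * ?f j\<rfloor>" "\<lfloor>m * ?f j0\<rfloor>"] by (simp add: B_def b_def)
        then have "\<bar>m * ?f j - m * ?f j0\<bar> < 1" by linarith
        then have "m * \<bar>?f j - ?f j0\<bar> < 1"
          by (metis abs_mult abs_of_nat right_diff_distrib)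
        then have "\<bar>?f j - ?f j0\<bar> < 1 / m" using m(1) by (simp add: field_simps)
        also have "1 / m \<le> \<delta>" using m(1,2) assms(1) by (simp add: field_simps)
        finally have "\<bar>real (j - j0) * x - (\<lfloor>real j * x\<rfloor> - \<lfloor>real j0 * x\<rfloor>)\<bar> < \<delta>"
          using j0(2)[OF j] by (simp add: frac_def of_nat_diff algebra_simps)
        then have "\<bar>real (j - j0) * x - of_int (\<lfloor>real j * x\<rfloor> - \<lfloor>real j0 * x\<rfloor>)\<bar> < \<delta>" by simp
        moreover have "j - j0 \<in> {1..N}" using j j0(2)[OF j] False by (auto simp: B_def)
        ultimately show ?thesis unfolding G_def by blast
      qed simp
    qed
    moreover have "inj_on (\<lambda>j. j - j0) (B i)"
      using j0(2) by (intro inj_on_diff_nat) auto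
    ultimately have "card (B i) \<le> card (insert 0 G)"
      by (intro card_inj_on_le[of "\<lambda>j. j - j0"]) (auto simp: G_def)
    also have "\<dots> \<le> card G + 1" by (simp add: card_insert_le_m1 G_def)
    finally show ?thesis .
  qed simp
  have "N + 1 = card (\<Union>i<m. B i)"
  proof -
    have "(\<Union>i<m. B i) = {0..N}" using b by (auto simp: B_def)
    then show ?thesis by simp
  qed
  also have "\<dots> \<le> (\<Sum>i<m. card (B i))" by (intro card_UN_le) auto
  also have "\<dots> \<le> (\<Sum>i<m. card G + 1)" by (intro sum_mono card_B)
  finally have "N + 1 \<le> m * (card G + 1)" by simp
  then have "real (N + 1) \<le> real (m * (card G + 1))" by (simp only: of_nat_le_iff)
  then have "real N \<le> m * (real (card G) + 1)" by (simp add: algebra_simps)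
  also have "\<dots> \<le> 2 / \<delta> * (real (card G) + 1)" using m(3) by (intro mult_right_mono) auto
  finally have "N * \<delta> / 2 \<le> real (card G) + 1" using assms(1) by (simp add: field_simps)
  then show ?thesis by (simp add: G_def)
qed

text \<open>Abel summation over the scales \<open>2^j\<close>: at least about \<open>2^j \<psi>(2^j)\<close> of the \<open>q \<le> 2^j\<close> satisfy
  \<open>\<parallel>q x\<parallel> < \<psi>(2^j) \<le> \<psi> q\<close>, so the sum is at least of order \<open>\<Sum>\<^sub>j 2^j \<psi>(2^j)^d\<close>, a harmonic series.\<close>

lemma not_summable_fiber:
  fixes x :: real and d M :: nat and \<psi> :: "nat \<Rightarrow> real"
  assumes "d \<ge> 2" "M \<ge> 2"
    and \<psi>: "\<And>q. q \<ge> 2 \<Longrightarrow> \<psi> q = (real q * ln (real q)) powr (- 1 / real d)"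
  shows "\<not> summable (\<lambda>q. (if q \<ge> M \<and> (\<exists>p::int. \<bar>real q * x - p\<bar> < \<psi> q) then \<psi> q else 0) ^ (d - 1))"
    (is "\<not> summable ?g")
proof
  assume sm: "summable ?g"
  define P where "P j = \<psi> (2 ^ j)" for j
  have P: "P j = (2 ^ j * (real j * ln 2)) powr (- 1 / real d)" if "j \<ge> 1" for j
  proof -
    have "(2::nat) ^ 1 \<le> 2 ^ j" using that by (intro power_increasing) auto
    then show ?thesis unfolding P_def by (subst \<psi>) (auto simp: ln_realpow)
  qed
  have \<psi>pos: "\<psi> q > 0" if "q \<ge> 2" for q using that \<psi>[OF that] by simp
  have Ppos: "P j > 0" if "j \<ge> 1" for j using P[OF that] that by simp
  have \<psi>mono: "\<psi> r \<le> \<psi> q" if "2 \<le> q" "q \<le> r" for q r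
  proof -
    have "real q * ln (real q) \<le> real r * ln (real r)"
      using that by (intro mult_mono) auto
    then show ?thesis using that
      by (subst (1 2) \<psi>) (auto intro!: powr_mono2')
  qed
  \<comment> \<open>\<open>q ln q\<close> at least doubles between consecutive dyadic scales, so
    \<open>P j ^ (d - 1)\<close> shrinks at least by the factor \<open>\<theta>\<close>.\<close>
  define \<theta> where "\<theta> = (2 powr (- 1 / real d)) ^ (d - 1)"
  have \<theta>: "0 < \<theta>" "\<theta> < 1"
  proof -
    have "2 powr (- 1 / real d) < 2 powr 0" using assms(1) by (intro powr_less_mono) auto
    then have "2 powr (- 1 / real d) < 1" by simp
    then show "0 < \<theta>" "\<theta> < 1" unfolding \<theta>_def using assms(1)
      by (auto intro!: power_less_one_iff[THEN iffD2])
  qed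
  have Pstep: "P (Suc j) ^ (d - 1) \<le> \<theta> * P j ^ (d - 1)" if "j \<ge> 1" for j
  proof -
    have "P (Suc j) \<le> (2 * (2 ^ j * (real j * ln 2))) powr (- 1 / real d)"
      using that by (subst P) (auto intro!: powr_mono2' mult_left_mono)
    also have "\<dots> = 2 powr (- 1 / real d) * P j"
      using that by (subst powr_mult) (auto simp: P)
    finally show ?thesis
      unfolding \<theta>_def power_mult_distrib[symmetric] using Ppos[of "Suc j"] by (intro power_mono) auto
  qed
  \<comment> \<open>The Abel weights: they telescope, and each is still a fixed proportion of
    \<open>P j ^ (d - 1)\<close>.\<close>
  define w where "w j = P j ^ (d - 1) - P (Suc j) ^ (d - 1)" for j
  have w: "w j \<ge> (1 - \<theta>) * P j ^ (d - 1)" if "j \<ge> 1" for j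
    using Pstep[OF that] by (simp add: w_def algebra_simps)
  have w0: "w j \<ge> 0" if "j \<ge> 1" for j
    using w[OF that] \<theta> Ppos[OF that] by (meson diff_ge_0_iff_ge less_imp_le mult_nonneg_nonneg order_trans zero_le_power)
  have Ppow: "2 ^ j * P j ^ d = 1 / (real j * ln 2)" if "j \<ge> 1" for j
  proof -
    have "P j ^ d = P j powr real d" using Ppos[OF that] by (simp add: powr_realpow)
    also have "\<dots> = (2 ^ j * (real j * ln 2)) powr (- 1)"
      using assms(1) by (simp add: P[OF that] powr_powr)
    also have "\<dots> = 1 / (2 ^ j * (real j * ln 2))" using that by (simp add: powr_minus_divide)
    finally show ?thesis by simp
  qed
  \<comment> \<open>A minorant of \<open>2 ^ j * P j\<close>, from \<open>ln 2 < 1\<close> and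
    \<open>1/d \<le> 1/2\<close>. The threshold \<open>4 * (1 + M)\<close> ensures that dropping
    \<open>q < M\<close> and the pigeonhole loss 1 cost at most half of the main term.\<close>
  have "filterlim (\<lambda>j::nat. 2 ^ j * (2 ^ j * real j) powr (- 1 / 2)) at_top sequentially"
    by real_asymp
  then have "\<forall>\<^sub>F j in sequentially. 2 ^ j * (2 ^ j * real j) powr (- 1 / 2) \<ge> 4 * (1 + real M)"
    by (simp add: filterlim_at_top)
  moreover have "\<forall>\<^sub>F j in sequentially. P j \<le> 1"
  proof -
    have "\<forall>\<^sub>F j in sequentially. 2 ^ j * (real j * ln 2) \<ge> (1::real)" by real_asymp
    then show ?thesis using eventually_ge_at_top[of "1::nat"]
    proof eventually_elim
      case (elim j)
      have "(2 ^ j * (real j * ln 2)) powr (- 1 / real d) \<le> (2 ^ j * (real j * ln 2)) powr 0"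
        using elim by (intro powr_mono) auto
      also have "\<dots> \<le> 1" by simp
      finally show ?case using P[OF elim(2)] by simp
    qed
  qed
  moreover have "\<forall>\<^sub>F j in sequentially. j \<ge> (1::nat)" by (rule eventually_ge_at_top)
  ultimately have "\<forall>\<^sub>F j in sequentially. 2 ^ j * P j \<ge> 4 * (1 + real M) \<and> P j \<le> 1 \<and> j \<ge> 1"
  proof eventually_elim
    case (elim j)
    have "2 ^ j * (real j * ln 2) \<le> 2 ^ j * real j"
      using ln_2_less_1 by (intro mult_left_mono) (auto intro: mult_left_le)
    then have "(2 ^ j * real j) powr (- 1 / real d) \<le> P j"
      using elim by (subst P) (auto intro!: powr_mono2')
    moreover have "(2 ^ j * real j) powr (- 1 / 2) \<le> (2 ^ j * real j) powr (- 1 / real d)"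
    proof (rule powr_mono)
      show "- 1 / 2 \<le> - 1 / real d" using assms(1) by (simp add: field_simps)
      have "(1::real) * 1 \<le> 2 ^ j * real j" using elim by (intro mult_mono) auto
      then show "1 \<le> 2 ^ j * real j" by simp
    qed
    ultimately have "2 ^ j * (2 ^ j * real j) powr (- 1 / 2) \<le> 2 ^ j * P j"
      by (intro mult_left_mono) auto
    with elim show ?case by (intro conjI) linarith+
  qed
  then obtain J where J: "\<And>j. j \<ge> J \<Longrightarrow> 2 ^ j * P j \<ge> 4 * (1 + real M)" "\<And>j. j \<ge> J \<Longrightarrow> P j \<le> 1"
      "\<And>j. j \<ge> J \<Longrightarrow> j \<ge> 1"
    unfolding eventually_sequentially by blast
  define G where "G j = {q \<in> {M..2 ^ j}. \<exists>p::int. \<bar>real q * x - p\<bar> < P j}" for j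
  have card_G: "real (card (G j)) \<ge> 2 ^ j * P j / 4" if "j \<ge> J" for j
  proof -
    have "{q \<in> {1..2 ^ j}. \<exists>p::int. \<bar>real q * x - p\<bar> < P j} \<subseteq> G j \<union> {1..M}"
      by (auto simp: G_def)
    then have "card {q \<in> {1..2 ^ j}. \<exists>p::int. \<bar>real q * x - p\<bar> < P j} \<le> card (G j \<union> {1..M})"
      by (intro card_mono) (auto simp: G_def)
    also have "\<dots> \<le> card (G j) + M" using card_Un_le[of "G j" "{1..M}"] by simp
    finally have "real (card (G j)) + M \<ge> real (2 ^ j) * P j / 2 - 1"
      using card_near_integer_multiples_ge[of "P j" "2 ^ j" x] Ppos[OF J(3)[OF that]] J(2)[OF that]
      by simp
    then show ?thesis using J(1)[OF that] by simp
  qed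
  have gnn: "?g q \<ge> 0" for q using \<psi>pos[of q] assms(2) by (auto intro!: zero_le_power less_imp_le)
  \<comment> \<open>The product of \<open>1 - \<theta>\<close> from the weights, 1/4 from
    \<open>card_G\<close> and \<open>1 / ln 2\<close> from \<open>Ppow\<close>.\<close>
  define c where "c = (1 - \<theta>) / (4 * ln 2)"
  have "c > 0" using \<theta> by (simp add: c_def)
  have bound: "(\<Sum>j\<in>{J..n}. c * inverse (real j)) \<le> suminf ?g" for n
  proof -
    have "(\<Sum>j\<in>{J..n}. c * inverse (real j)) \<le> (\<Sum>j\<in>{J..n}. w j * card (G j))"
    proof (rule sum_mono)
      fix j assume "j \<in> {J..n}"
      then have j: "j \<ge> J" "j \<ge> 1" using J(3) by auto
      have "P j ^ d = P j ^ (d - 1) * P j" using assms(1) by (metis One_nat_def Suc_1 Suc_diff_1 less_le_trans power_Suc2 zero_less_Suc)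
      then have "(1 - \<theta>) * P j ^ (d - 1) * (2 ^ j * P j / 4) = (1 - \<theta>) / 4 * (2 ^ j * P j ^ d)" by simp
      also have "\<dots> = c * inverse (real j)" using j unfolding Ppow[OF j(2)] c_def by (simp add: divide_simps)
      finally have "c * inverse (real j) = (1 - \<theta>) * P j ^ (d - 1) * (2 ^ j * P j / 4)" ..
      also have "\<dots> \<le> w j * card (G j)"
        using w[OF j(2)] w0[OF j(2)] card_G[OF j(1)] Ppos[OF j(2)] by (intro mult_mono) auto
      finally show "c * inverse (real j) \<le> w j * card (G j)" .
    qed
    also have "\<dots> = (\<Sum>j\<in>{J..n}. \<Sum>q\<in>{..2 ^ n}. if q \<in> G j then w j else 0)"
    proof (rule sum.cong[OF refl])
      fix j assume "j \<in> {J..n}"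
      have "G j \<subseteq> {..2 ^ j}" by (auto simp: G_def)
      also have "\<dots> \<subseteq> {..2 ^ n}" using \<open>j \<in> {J..n}\<close> by simp
      finally have "G j \<subseteq> {..2 ^ n}" .
      then have "{..2 ^ n} \<inter> {q. q \<in> G j} = G j" by auto
      then show "w j * card (G j) = (\<Sum>q\<in>{..2 ^ n}. if q \<in> G j then w j else 0)"
        by (simp add: sum.If_cases)
    qed
    also have "\<dots> = (\<Sum>q\<in>{..2 ^ n}. \<Sum>j\<in>{J..n}. if q \<in> G j then w j else 0)"
      by (rule sum.swap)
    also have "\<dots> \<le> (\<Sum>q\<in>{..2 ^ n}. ?g q)"
    proof (rule sum_mono)
      fix q
      show "(\<Sum>j\<in>{J..n}. if q \<in> G j then w j else 0) \<le> ?g q"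
      proof (cases "\<exists>j\<in>{J..n}. q \<in> G j")
        case False
        then have "(\<Sum>j\<in>{J..n}. if q \<in> G j then w j else 0) = 0" by (intro sum.neutral) auto
        then show ?thesis using gnn[of q] by linarith
      next
        case True
        \<comment> \<open>From the first scale containing \<open>q\<close> on, the weights telescope
          to at most \<open>P j0 ^ (d - 1)\<close>. As \<open>q \<le> 2 ^ j0\<close>, monotonicity
          bounds this by \<open>\<psi> q ^ (d - 1)\<close>.\<close>
        define j0 where "j0 = (LEAST j. j \<in> {J..n} \<and> q \<in> G j)"
        from True obtain j1 where "j1 \<in> {J..n} \<and> q \<in> G j1" by blast
        then have "j0 \<in> {J..n} \<and> q \<in> G j0"
          unfolding j0_def by (rule LeastI)
        then have j0: "j0 \<in> {J..n}" "q \<in> G j0" by auto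
        have least: "j0 \<le> j" if "j \<in> {J..n}" "q \<in> G j" for j
          unfolding j0_def by (rule Least_le) (use that in blast)
        have "j0 \<ge> 1" using j0 J(3) by auto
        have "(\<Sum>j\<in>{J..n}. if q \<in> G j then w j else 0) = (\<Sum>j\<in>{J..n} \<inter> {j. q \<in> G j}. w j)"
          by (simp add: sum.If_cases)
        also have "\<dots> \<le> (\<Sum>j\<in>{j0..n}. w j)"
          using least \<open>j0 \<ge> 1\<close> by (intro sum_mono2) (auto intro!: w0)
        also have "\<dots> = P j0 ^ (d - 1) - P (Suc n) ^ (d - 1)"
          unfolding w_def using j0(1) sum_Suc_diff'[of j0 "Suc n" "\<lambda>j. - (P j ^ (d - 1))"]
          by (simp add: atLeastLessThanSuc_atLeastAtMost)
        also have "\<dots> \<le> P j0 ^ (d - 1)" using Ppos[of "Suc n"] by simp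
        also have "\<dots> \<le> \<psi> q ^ (d - 1)"
        proof (rule power_mono)
          show "P j0 \<le> \<psi> q" unfolding P_def using j0(2) assms(2) by (intro \<psi>mono) (auto simp: G_def)
          show "0 \<le> P j0" using Ppos[OF \<open>j0 \<ge> 1\<close>] by simp
        qed
        also have "\<dots> = ?g q"
        proof -
          have q: "q \<ge> M" "q \<le> 2 ^ j0" using j0(2) by (auto simp: G_def)
          obtain p :: int where "\<bar>real q * x - p\<bar> < P j0" using j0(2) by (auto simp: G_def)
          also have "P j0 \<le> \<psi> q" unfolding P_def using q assms(2) by (intro \<psi>mono) auto
          finally show ?thesis using q by auto
        qed
        finally show ?thesis .
      qed
    qed
    also have "\<dots> \<le> suminf ?g" using gnn by (intro sum_le_suminf sm) auto
    finally show ?thesis .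
  qed
  have "summable (\<lambda>j. c * inverse (real (j + J)))"
  proof (rule summableI_nonneg_bounded)
    fix n
    have "(\<Sum>j<n. c * inverse (real (j + J))) = (\<Sum>j\<in>{J..<n + J}. c * inverse (real j))"
      using sum.shift_bounds_nat_ivl[of "\<lambda>j. c * inverse (real j)" 0 J n]
      by (simp only: atLeast0LessThan add_0)
    also have "\<dots> \<le> (\<Sum>j\<in>{J..n + J}. c * inverse (real j))"
      using \<open>c > 0\<close> by (intro sum_mono2) auto
    also have "\<dots> \<le> suminf ?g" by (rule bound)
    finally show "(\<Sum>j<n. c * inverse (real (j + J))) \<le> suminf ?g" .
  qed (use \<open>c > 0\<close> in auto)
  then have "summable (\<lambda>j. c * inverse (real j))"
    by (rule summable_iff_shift[of "\<lambda>j. c * inverse (real j)", THEN iffD1])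
  then have "summable (\<lambda>j. inverse (real j))" using \<open>c > 0\<close> by (simp add: summable_cmult_iff)
  then show False using not_summable_harmonic[where 'a = real] by simp
qed

section \<open>Transfer to the fibre over \<open>x\<close>\<close>

theorem theorem1:
  fixes d :: nat and \<psi> :: "nat \<Rightarrow> real" and x :: real
  assumes "d \<ge> 3"
    and "DIM(real \<times> (real ^ 'n)) = d"
    and "\<forall>q\<ge>1. \<psi> q \<ge> 0"
    and "\<forall>q\<ge>2. \<psi> q = (real q * ln (real q)) powr (- 1 / real d)"
  shows "AE y in (lebesgue :: (real ^ 'n) measure). (x, y) \<in> \<W> \<psi>"
proof -
  have card: "CARD('n) = d - 1" using assms(2) by simp
  have "(\<lambda>q. \<psi> q) \<longlonglongrightarrow> 0"
  proof -
    have "filterlim (\<lambda>q::nat. real q * ln (real q)) at_top sequentially" by real_asymp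
    then have "((\<lambda>q::nat. (real q * ln (real q)) powr (- 1 / real d)) \<longlongrightarrow> 0) sequentially"
      using assms(1) by (intro tendsto_neg_powr) auto
    then show ?thesis
      by (rule Lim_transform_eventually)
         (use assms(4) in \<open>auto simp: eventually_sequentially intro!: exI[of _ 2]\<close>)
  qed
  then have "\<forall>\<^sub>F q in sequentially. \<psi> q < 1/2" by (rule order_tendstoD) auto
  then obtain M0 where M0: "\<And>q. q \<ge> M0 \<Longrightarrow> \<psi> q < 1/2" by (auto simp: eventually_sequentially)
  \<comment> \<open>From \<open>M\<close> on, both the bound \<open>\<psi> q < 1/2\<close> and the
    formula for \<open>\<psi>\<close> are available.\<close>
  define M where "M = max M0 2"
  \<comment> \<open>The value 0 excludes a denominator, since no absolute value is below 0. Hence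
    every solution for \<open>y\<close> also carries a first coordinate approximating
    \<open>x\<close>.\<close>
  define a where "a q = (if q \<ge> M \<and> (\<exists>p::int. \<bar>real q * x - p\<bar> < \<psi> q) then \<psi> q else 0)" for q
  have "AE y in (lebesgue :: (real ^ 'n) measure).
      infinite {q. \<exists>p :: 'n \<Rightarrow> int. \<forall>i. \<bar>real q * y $ i - p i\<bar> < a q}"
  proof (rule gallagher_khintchine)
    show "CARD('n) \<ge> 2" using card assms(1) by simp
    show "0 \<le> a q" for q using assms(3) by (auto simp: a_def M_def)
    show "a q \<le> 1/2" for q using M0[of q] by (auto simp: a_def M_def)
    show "\<not> summable (\<lambda>q. a q ^ CARD('n))"
      unfolding a_def card by (rule not_summable_fiber) (use assms in \<open>auto simp: M_def\<close>)
  qed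
  then show ?thesis
  proof (rule AE_mp, intro AE_I2 impI)
    fix y :: "real ^ 'n"
    assume inf: "infinite {q. \<exists>p :: 'n \<Rightarrow> int. \<forall>i. \<bar>real q * y $ i - p i\<bar> < a q}"
    let ?S = "{(p :: real \<times> (real ^ 'n), q :: nat). (\<forall>b\<in>Basis. p \<bullet> b \<in> \<int>) \<and> 1 \<le> q \<and>
        infnorm (real q *\<^sub>R (x, y) - p) < \<psi> q}"
    \<comment> \<open>Infinitely many denominators already force infinitely many pairs.\<close>
    have "{q. \<exists>p :: 'n \<Rightarrow> int. \<forall>i. \<bar>real q * y $ i - p i\<bar> < a q} \<subseteq> snd ` ?S"
    proof
      fix q assume "q \<in> {q. \<exists>p :: 'n \<Rightarrow> int. \<forall>i. \<bar>real q * y $ i - p i\<bar> < a q}"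
      then obtain p :: "'n \<Rightarrow> int" where p: "\<And>i. \<bar>real q * y $ i - p i\<bar> < a q" by blast
      then have "a q > 0" by (meson abs_ge_zero le_less_trans)
      then have "q \<ge> M" "a q = \<psi> q" "\<exists>p0::int. \<bar>real q * x - p0\<bar> < \<psi> q"
        by (auto simp: a_def split: if_splits)
      then obtain p0 :: int where p0: "\<bar>real q * x - p0\<bar> < \<psi> q" by blast
      let ?p = "(of_int p0, \<chi> i. of_int (p i)) :: real \<times> (real ^ 'n)"
      have "(?p, q) \<in> ?S"
        using p p0 \<open>q \<ge> M\<close> \<open>a q = \<psi> q\<close>
        by (auto simp: infnorm_Max Basis_prod_def Basis_vec_def inner_axis M_def)
      then show "q \<in> snd ` ?S" by force
    qed
    with inf have "infinite ?S" by (meson finite_imageI finite_subset)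
    then show "(x, y) \<in> \<W> \<psi>" by (simp add: approximable_points_def)
  qed
qed

end
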